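(* Let $O^{(1)},\dots,O^{(k)}$ be arbitrary operators on $h$ and let $t_1,\dots,t_k\in\{0,\dots,N-1\}$, where repetitions are allowed. Then $$\mathrm{Tr}\Big[Pe^{i\epsilon\mathcal P}\,O^{(1)}_{t_1}\cdots O^{(k)}_{t_k}\Big]=\mathrm{tr}\Big[\hat T\big[O^{(1)}(t_1)\cdots O^{(k)}(t_k)\big]\Big],$$ where $O^{(l)}(t_l)$ denotes the operator $O^{(l)}$ itself, carrying the time label $t_l$.
   Context: Fix integers $L\ge1$, $N\ge1$, a real $\epsilon>0$, and set $T=\epsilon N$. The space $h$. Let $h$ be the fermionic Fock space of $L$ modes, with vacuum $|0\rangle$, ladder operators $a_i$ satisfying $\{a_i,a_j^\dagger\}=\delta_{ij}$ and $\{a_i,a_j\}=\{a_i^\dagger,a_j^\dagger\}=0$, and trace $\mathrm{tr}$. The space $\mathcal H$. Let $\mathcal H$ be the Fock space generated from a vacuum $|\Omega\rangle$ by $a_{ti}$, $t=0,\dots,N-1$, $i=1,\dots,L$, with $\{a_{ti},a^\dagger_{t'j}\}=\delta_{tt'}\delta_{ij}$ and all other anticommutators zero. The symbol $\mathrm{Tr}$ is the trace on $\mathcal H$. Time translations and parity. Set $\omega_n=(2n+1)\pi/T$ and $\hat a_{ni}=N^{-1/2}\sum_te^{i\omega_n\epsilon t}a_{ti}$. Define $$\mathcal P=\sum_{n,j}\omega_n\hat a^\dagger_{nj}\hat a_{nj},\qquad P=\exp\Big(i\pi\sum_{t,i}a^\dagger_{ti}a_{ti}\Big).$$ Placing operators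 on a slice. For an operator $O$ on $h$, $O_t$ denotes its image under the unital $*$-homomorphism determined by $a_i\mapsto a_{ti}$. Equivalently, substitute $a_i\to a_{ti}$ and $a_j^\dagger\to a^\dagger_{tj}$ in a polynomial expression of $O$. Parity. An operator on $h$ is even (resp. odd) if it commutes (resp. anticommutes) with $e^{i\pi\sum_ia_i^\dagger a_i}$. Fermionic time ordering $\hat T$. Let $B_1,\dots,B_k$ be operators of definite parity with real labels $s_1,\dots,s_k$. Let $\sigma$ be the unique permutation with $s_{\sigma(1)}\ge\dots\ge s_{\sigma(k)}$ that preserves the relative order of equal labels. Define $$\hat T[B_1\cdots B_k]=(-1)^\gamma B_{\sigma(1)}\cdots B_{\sigma(k)},$$ where $\gamma$ is the number of pairs of odd operators whose order is reversed by $\sigma$. $\hat T$ is extended multilinearly by splitting operators into even and odd parts. *)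

theory Defs
  imports Complex_Main "HOL-Library.Product_Lexorder" "HOL-Combinatorics.Permutations"
begin

text \<open>A fermionic Fock space over a finite, linearly ordered set of modes M has the
orthonormal occupation-number basis |S>, S a subset of M.  An operator is represented by
its matrix elements X S T = <S|X|T>; it is an operator on the Fock space over M iff
its matrix elements vanish outside Pow M x Pow M.  Ladder operators are the standard
Jordan-Wigner ones: a_i |T> = (-1)^(number of j in T with j < i) |T - {i}> if i in T,
and 0 otherwise.\<close>

type_synonym 'm op = "'m set \<Rightarrow> 'm set \<Rightarrow> complex"

definition is_op :: "'m set \<Rightarrow> 'm op \<Rightarrow> bool" where
  "is_op M X \<longleftrightarrow> (\<forall>S T. X S T \<noteq> 0 \<longrightarrow> S \<subseteq> M \<and> T \<subseteq> M)"

definition op_zero :: "'m op" where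
  "op_zero = (\<lambda>S T. 0)"

definition op_one :: "'m set \<Rightarrow> 'm op" where
  "op_one M = (\<lambda>S T. if S = T \<and> S \<subseteq> M then 1 else 0)"

definition op_add :: "'m op \<Rightarrow> 'm op \<Rightarrow> 'm op" where
  "op_add X Y = (\<lambda>S T. X S T + Y S T)"

definition op_diff :: "'m op \<Rightarrow> 'm op \<Rightarrow> 'm op" where
  "op_diff X Y = (\<lambda>S T. X S T - Y S T)"

definition op_scale :: "complex \<Rightarrow> 'm op \<Rightarrow> 'm op" where
  "op_scale c X = (\<lambda>S T. c * X S T)"

definition op_sum :: "('i \<Rightarrow> 'm op) \<Rightarrow> 'i set \<Rightarrow> 'm op" where
  "op_sum f A = (\<lambda>S T. \<Sum>a\<in>A. f a S T)"

definition op_mult :: "'m set \<Rightarrow> 'm op \<Rightarrow> 'm op \<Rightarrow> 'm op" where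
  "op_mult M X Y = (\<lambda>S U. \<Sum>T\<in>Pow M. X S T * Y T U)"

definition op_adj :: "'m op \<Rightarrow> 'm op" where
  "op_adj X = (\<lambda>S T. cnj (X T S))"

definition op_trace :: "'m set \<Rightarrow> 'm op \<Rightarrow> complex" where
  "op_trace M X = (\<Sum>S\<in>Pow M. X S S)"

fun op_pow :: "'m set \<Rightarrow> 'm op \<Rightarrow> nat \<Rightarrow> 'm op" where
  "op_pow M X 0 = op_one M"
| "op_pow M X (Suc n) = op_mult M X (op_pow M X n)"

definition op_exp :: "'m set \<Rightarrow> 'm op \<Rightarrow> 'm op" where
  "op_exp M X = (\<lambda>S T. \<Sum>n. op_pow M X n S T / of_nat (fact n))"

fun op_list_prod :: "'m set \<Rightarrow> 'm op list \<Rightarrow> 'm op" where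
  "op_list_prod M [] = op_one M"
| "op_list_prod M (X # Xs) = op_mult M X (op_list_prod M Xs)"

definition ann :: "'m::linorder set \<Rightarrow> 'm \<Rightarrow> 'm op" where
  "ann M i = (\<lambda>S T. if i \<in> M \<and> T \<subseteq> M \<and> i \<in> T \<and> S = T - {i}
                     then (-1) ^ card {j\<in>T. j < i} else 0)"

definition cre :: "'m::linorder set \<Rightarrow> 'm \<Rightarrow> 'm op" where
  "cre M i = op_adj (ann M i)"

definition number_op :: "'m::linorder set \<Rightarrow> 'm op" where
  "number_op M = op_sum (\<lambda>i. op_mult M (cre M i) (ann M i)) M"

definition parity_op :: "'m::linorder set \<Rightarrow> 'm op" where
  "parity_op M = op_exp M (op_scale (\<i> * of_real pi) (number_op M))"

text \<open>Modes of h: i = 1..L.  Modes of \<H>: (t,i) with t = 0..N-1, i = 1..L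
(ordered lexicographically for the Jordan-Wigner signs).\<close>

definition modes_h :: "nat \<Rightarrow> nat set" where
  "modes_h L = {1..L}"

definition modes_H :: "nat \<Rightarrow> nat \<Rightarrow> (nat \<times> nat) set" where
  "modes_H N L = {0..<N} \<times> {1..L}"

definition omega :: "real \<Rightarrow> nat \<Rightarrow> nat \<Rightarrow> real" where
  "omega \<epsilon> N n = (2 * real n + 1) * pi / (\<epsilon> * real N)"

definition ahat :: "real \<Rightarrow> nat \<Rightarrow> nat \<Rightarrow> nat \<Rightarrow> nat \<Rightarrow> (nat \<times> nat) op" where
  "ahat \<epsilon> N L n i = op_scale (of_real (1 / sqrt (real N)))
     (op_sum (\<lambda>t. op_scale (exp (\<i> * of_real (omega \<epsilon> N n * \<epsilon> * real t))) (ann (modes_H N L) (t, i)))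
             {0..<N})"

definition calP :: "real \<Rightarrow> nat \<Rightarrow> nat \<Rightarrow> (nat \<times> nat) op" where
  "calP \<epsilon> N L = op_sum (\<lambda>(n, j). op_scale (of_real (omega \<epsilon> N n))
       (op_mult (modes_H N L) (op_adj (ahat \<epsilon> N L n j)) (ahat \<epsilon> N L n j))) ({0..<N} \<times> {1..L})"

definition unital_star_hom :: "'a set \<Rightarrow> 'b set \<Rightarrow> ('a op \<Rightarrow> 'b op) \<Rightarrow> bool" where
  "unital_star_hom A B \<phi> \<longleftrightarrow>
     (\<forall>X. is_op A X \<longrightarrow> is_op B (\<phi> X)) \<and>
     (\<forall>X. \<not> is_op A X \<longrightarrow> \<phi> X = op_zero) \<and>
     (\<forall>X Y. is_op A X \<longrightarrow> is_op A Y \<longrightarrow> \<phi> (op_add X Y) = op_add (\<phi> X) (\<phi> Y)) \<and>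
     (\<forall>c X. is_op A X \<longrightarrow> \<phi> (op_scale c X) = op_scale c (\<phi> X)) \<and>
     (\<forall>X Y. is_op A X \<longrightarrow> is_op A Y \<longrightarrow> \<phi> (op_mult A X Y) = op_mult B (\<phi> X) (\<phi> Y)) \<and>
     \<phi> (op_one A) = op_one B \<and>
     (\<forall>X. is_op A X \<longrightarrow> \<phi> (op_adj X) = op_adj (\<phi> X))"

text \<open>O_t: image of O under the unital *-homomorphism determined by a_i \<mapsto> a_{ti}
(normalised to send non-operators to 0, which fixes it uniquely as a HOL function).\<close>
definition slice :: "nat \<Rightarrow> nat \<Rightarrow> nat \<Rightarrow> nat op \<Rightarrow> (nat \<times> nat) op" where
  "slice N L t X = (THE \<phi>. unital_star_hom (modes_h L) (modes_H N L) \<phi> \<and>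
       (\<forall>i\<in>{1..L}. \<phi> (ann (modes_h L) i) = ann (modes_H N L) (t, i))) X"

definition is_even_op :: "nat \<Rightarrow> nat op \<Rightarrow> bool" where
  "is_even_op L X \<longleftrightarrow> op_mult (modes_h L) X (parity_op (modes_h L))
                       = op_mult (modes_h L) (parity_op (modes_h L)) X"

definition is_odd_op :: "nat \<Rightarrow> nat op \<Rightarrow> bool" where
  "is_odd_op L X \<longleftrightarrow> op_mult (modes_h L) X (parity_op (modes_h L))
                       = op_scale (-1) (op_mult (modes_h L) (parity_op (modes_h L)) X)"

definition even_part :: "nat \<Rightarrow> nat op \<Rightarrow> nat op" where
  "even_part L X = (THE E. is_op (modes_h L) E \<and> is_even_op L E \<and> is_odd_op L (op_diff X E))"

definition odd_part :: "nat \<Rightarrow> nat op \<Rightarrow> nat op" where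
  "odd_part L X = op_diff X (even_part L X)"

definition sort_perm :: "nat \<Rightarrow> (nat \<Rightarrow> real) \<Rightarrow> nat \<Rightarrow> nat" where
  "sort_perm k s = (THE \<sigma>. \<sigma> permutes {0..<k} \<and>
       (\<forall>p q. p < q \<and> q < k \<longrightarrow> s (\<sigma> q) \<le> s (\<sigma> p)) \<and>
       (\<forall>p q. p < q \<and> q < k \<and> s (\<sigma> p) = s (\<sigma> q) \<longrightarrow> \<sigma> p < \<sigma> q))"

text \<open>Fermionic time ordering of B_0 ... B_{k-1} with labels s_0 ... s_{k-1}, extended
multilinearly: sum over the set A of indices for which the odd part is taken; gamma counts
pairs of odd factors whose order is reversed by sigma.\<close>
definition time_order :: "nat \<Rightarrow> nat \<Rightarrow> (nat \<Rightarrow> nat op) \<Rightarrow> (nat \<Rightarrow> real) \<Rightarrow> nat op" where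
  "time_order L k B s =
     (let \<sigma> = sort_perm k s in
      op_sum (\<lambda>A. op_scale ((-1) ^ card {(p, q). p < q \<and> q < k \<and> \<sigma> p \<in> A \<and> \<sigma> q \<in> A \<and> \<sigma> q < \<sigma> p})
                 (op_list_prod (modes_h L)
                    (map (\<lambda>p. if \<sigma> p \<in> A then odd_part L (B (\<sigma> p)) else even_part L (B (\<sigma> p)))
                         [0..<k])))
             (Pow {0..<k}))"

end

theory Submission
  imports Defs "HOL-Analysis.Complex_Transcendental"
begin

text \<open>
  In the occupation-number basis every operator in the trace is explicit up to a sign. Writing
  \<open>c\<^sub>n\<close> for the Fourier mode \<open>ahat\<close>, we have \<open>[\<P>, c\<^sub>n\<^sup>\<dagger>] = \<omega>\<^sub>n c\<^sub>n\<^sup>\<dagger>\<close>, so the operator \<open>e\<^sup>i\<^sup>\<epsilon>\<^sup>\<P>\<close> carries \<open>a\<^sup>\<dagger>\<^sub>t\<^sub>i\<close> to \<open>a\<^sup>\<dagger>\<^sub>t\<^sub>+\<^sub>1\<^sub>,\<^sub>i\<close>, with \<open>a\<^sup>\<dagger>\<^sub>N\<^sub>i = - a\<^sup>\<dagger>\<^sub>0\<^sub>i\<close>; it fixes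
  the vacuum, hence it permutes the basis states cyclically in time up to the sign
  \<open>(-1)\<^bsup>m(1 + r)\<^esup>\<close>, where \<open>m\<close> particles sit on the last slice and \<open>r\<close> on the others. A slice operator
  acts on its slice only, up to the Jordan-Wigner sign of the slices below it.

  Splitting each factor into its even and odd parts and reordering (factors on different slices
  commute or anticommute) reduces the claim to products \<open>X\<^sub>N\<^sub>-\<^sub>1 \<cdots> X\<^sub>0\<close> with one factor per slice.
  There the trace on the large space is a sum over closed paths of
  \<open>\<Prod>\<^sub>t \<langle>S\<^sub>t|X\<^sub>t|S\<^sub>t\<^sub>-\<^sub>1\<rangle>\<close>, all Jordan-Wigner signs cancelling against the parity and the sign of the shift,
  and this sum is the trace of \<open>X\<^sub>N\<^sub>-\<^sub>1 \<cdots> X\<^sub>0\<close> on the small space.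
\<close>

section \<open>Operator algebra and anticommutation relations\<close>

lemma sum_eq_single:
  assumes "finite A" and "\<And>x. x \<in> A \<Longrightarrow> x \<noteq> a \<Longrightarrow> f x = 0"
  shows "sum f A = (if a \<in> A then f a else 0)"
proof -
  have "sum f A = (\<Sum>x\<in>A. if x = a then f x else 0)"
    using assms(2) by (intro sum.cong) auto
  then show ?thesis
    using assms(1) by simp
qed

lemma op_mult_assoc:
  assumes "finite M"
  shows "op_mult M (op_mult M X Y) Z = op_mult M X (op_mult M Y Z)"
proof (intro ext)
  fix S U
  have "op_mult M (op_mult M X Y) Z S U = (\<Sum>T\<in>Pow M. \<Sum>R\<in>Pow M. X S R * Y R T * Z T U)"
    by (simp add: op_mult_def sum_distrib_right)
  also have "\<dots> = (\<Sum>R\<in>Pow M. \<Sum>T\<in>Pow M. X S R * Y R T * Z T U)"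
    by (rule sum.swap)
  also have "\<dots> = op_mult M X (op_mult M Y Z) S U"
    by (simp add: op_mult_def sum_distrib_left mult.assoc)
  finally show "op_mult M (op_mult M X Y) Z S U = op_mult M X (op_mult M Y Z) S U" .
qed

lemma op_mult_add_left: "op_mult M (op_add X Y) Z = op_add (op_mult M X Z) (op_mult M Y Z)"
  by (simp add: fun_eq_iff op_mult_def op_add_def distrib_right sum.distrib)

lemma op_mult_add_right: "op_mult M X (op_add Y Z) = op_add (op_mult M X Y) (op_mult M X Z)"
  by (simp add: fun_eq_iff op_mult_def op_add_def distrib_left sum.distrib)

lemma op_mult_scale_left: "op_mult M (op_scale c X) Y = op_scale c (op_mult M X Y)"
  by (simp add: fun_eq_iff op_mult_def op_scale_def sum_distrib_left mult.assoc)

lemma op_mult_scale_right: "op_mult M X (op_scale c Y) = op_scale c (op_mult M X Y)"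
  by (simp add: fun_eq_iff op_mult_def op_scale_def sum_distrib_left mult.left_commute)

lemma op_mult_sum_left: "op_mult M (op_sum f A) Y = op_sum (\<lambda>a. op_mult M (f a) Y) A"
proof (intro ext)
  fix S U
  show "op_mult M (op_sum f A) Y S U = op_sum (\<lambda>a. op_mult M (f a) Y) A S U"
    unfolding op_mult_def op_sum_def sum_distrib_right by (rule sum.swap)
qed

lemma op_mult_sum_right: "op_mult M Y (op_sum f A) = op_sum (\<lambda>a. op_mult M Y (f a)) A"
proof (intro ext)
  fix S U
  show "op_mult M Y (op_sum f A) S U = op_sum (\<lambda>a. op_mult M Y (f a)) A S U"
    unfolding op_mult_def op_sum_def sum_distrib_left by (rule sum.swap)
qed

lemmas op_mult_linear = op_mult_add_left op_mult_add_right op_mult_scale_left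
  op_mult_scale_right op_mult_sum_left op_mult_sum_right

lemma op_scale_scale: "op_scale c (op_scale d X) = op_scale (c * d) X"
  by (simp add: op_scale_def mult.assoc)

lemma op_scale_one [simp]: "op_scale 1 X = X"
  by (simp add: op_scale_def)

lemma op_sum_cong: "(\<And>a. a \<in> A \<Longrightarrow> f a = g a) \<Longrightarrow> op_sum f A = op_sum g A"
  by (simp add: op_sum_def)

lemma op_mult_one_left:
  assumes "finite M" "is_op M X"
  shows "op_mult M (op_one M) X = X"
proof (intro ext)
  fix S U
  have "op_mult M (op_one M) X S U = (\<Sum>T\<in>Pow M. if T = S then X T U else 0)"
    unfolding op_mult_def op_one_def by (intro sum.cong) auto
  then show "op_mult M (op_one M) X S U = X S U"
    using assms by (auto simp: is_op_def)
qed

lemma op_mult_one_right: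
  assumes "finite M" "is_op M X"
  shows "op_mult M X (op_one M) = X"
proof (intro ext)
  fix S U
  have "op_mult M X (op_one M) S U = (\<Sum>T\<in>Pow M. if T = U then X S T else 0)"
    unfolding op_mult_def op_one_def by (intro sum.cong) auto
  then show "op_mult M X (op_one M) S U = X S U"
    using assms by (auto simp: is_op_def)
qed

lemma is_op_one [simp]: "is_op M (op_one M)"
  by (auto simp: is_op_def op_one_def)

lemma is_op_mult [simp]: "is_op M X \<Longrightarrow> is_op M Y \<Longrightarrow> is_op M (op_mult M X Y)"
  unfolding is_op_def op_mult_def by (metis (no_types, lifting) mult_eq_0_iff sum.neutral)

lemma is_op_add [simp]: "is_op M X \<Longrightarrow> is_op M Y \<Longrightarrow> is_op M (op_add X Y)"
  unfolding is_op_def op_add_def by (metis add_0)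

lemma is_op_scale [simp]: "is_op M X \<Longrightarrow> is_op M (op_scale c X)"
  unfolding is_op_def op_scale_def by auto

lemma is_op_adj [simp]: "is_op M X \<Longrightarrow> is_op M (op_adj X)"
  unfolding is_op_def op_adj_def by auto

lemma is_op_sum [simp]: "(\<And>a. a \<in> A \<Longrightarrow> is_op M (f a)) \<Longrightarrow> is_op M (op_sum f A)"
  unfolding is_op_def op_sum_def by (metis (no_types, lifting) sum.neutral)

lemma is_op_list_prod: "\<forall>X\<in>set Xs. is_op M X \<Longrightarrow> is_op M (op_list_prod M Xs)"
  by (induction Xs) auto

lemma op_list_prod_append:
  assumes "finite M" "\<forall>Y\<in>set Ys. is_op M Y"
  shows "op_list_prod M (Xs @ Ys) = op_mult M (op_list_prod M Xs) (op_list_prod M Ys)"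
  using assms by (induction Xs) (auto simp: op_mult_one_left op_mult_assoc is_op_list_prod)

lemma op_adj_scale: "op_adj (op_scale c X) = op_scale (cnj c) (op_adj X)"
  by (simp add: op_adj_def op_scale_def)

lemma op_adj_sum: "op_adj (op_sum f A) = op_sum (\<lambda>a. op_adj (f a)) A"
  by (simp add: op_adj_def op_sum_def)

lemma op_trace_scale: "op_trace M (op_scale c X) = c * op_trace M X"
  by (simp add: op_trace_def op_scale_def sum_distrib_left)

lemma op_trace_sum: "op_trace M (op_sum f A) = (\<Sum>a\<in>A. op_trace M (f a))"
  unfolding op_trace_def op_sum_def by (rule sum.swap)

section \<open>Jordan-Wigner signs and the matrix elements of ladder operators\<close>

definition jw :: "'m::linorder \<Rightarrow> 'm set \<Rightarrow> complex" where
  "jw i S = (-1) ^ card {j\<in>S. j < i}"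

lemma jw_square [simp]: "jw i S * jw i S = 1"
  by (simp add: jw_def flip: power_mult_distrib)

lemma jw_insert:
  assumes "finite S"
  shows "jw i (insert k S) = (if k \<notin> S \<and> k < i then - jw i S else jw i S)"
proof (cases "k \<notin> S \<and> k < i")
  case True
  then have "{j\<in>insert k S. j < i} = insert k {j\<in>S. j < i}" by auto
  with True assms show ?thesis by (simp add: jw_def)
next
  case False
  then have "{j\<in>insert k S. j < i} = {j\<in>S. j < i}" by auto
  with False show ?thesis by (simp add: jw_def)
qed

lemma jw_remove:
  assumes "finite S"
  shows "jw i (S - {k}) = (if k \<in> S \<and> k < i then - jw i S else jw i S)"
  using jw_insert[of "S - {k}" i k] assms by (cases "k \<in> S") (auto simp: insert_absorb)

lemma ann_apply:
  "ann M i S T = (if i \<in> M \<and> T \<subseteq> M \<and> i \<in> T \<and> S = T - {i} then jw i T else 0)"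
  by (simp add: ann_def jw_def)

lemma cre_apply:
  "cre M i S T = (if i \<in> M \<and> S \<subseteq> M \<and> i \<in> S \<and> T = S - {i} then jw i S else 0)"
  by (simp add: cre_def op_adj_def ann_apply jw_def)

lemma is_op_ann [simp]: "is_op M (ann M i)"
  by (auto simp: is_op_def ann_apply)

lemma is_op_cre [simp]: "is_op M (cre M i)"
  by (simp add: cre_def)

lemma cre_mult:
  assumes "finite M"
  shows "op_mult M (cre M i) X S U
    = (if i \<in> M \<and> S \<subseteq> M \<and> i \<in> S then jw i S * X (S - {i}) U else 0)"
  unfolding op_mult_def using assms
  by (subst sum_eq_single[of _ "S - {i}"]) (auto simp: cre_apply)

lemma mult_cre:
  assumes "finite M"
  shows "op_mult M X (cre M i) S U
    = (if i \<in> M \<and> U \<subseteq> M \<and> i \<notin> U then jw i U * X S (insert i U) else 0)"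
proof -
  have "finite U" if "U \<subseteq> M" using that assms finite_subset by blast
  then show ?thesis
    unfolding op_mult_def using assms
    by (subst sum_eq_single[of _ "insert i U"]) (auto simp: cre_apply jw_insert)
qed

lemma ann_mult:
  assumes "finite M"
  shows "op_mult M (ann M i) X S U
    = (if i \<in> M \<and> S \<subseteq> M \<and> i \<notin> S then jw i S * X (insert i S) U else 0)"
proof -
  have "finite S" if "S \<subseteq> M" using that assms finite_subset by blast
  then show ?thesis
    unfolding op_mult_def using assms
    by (subst sum_eq_single[of _ "insert i S"]) (auto simp: ann_apply jw_insert)
qed

text \<open>For \<open>x < y\<close>, removing \<open>x\<close> first flips \<open>jw y\<close>,
  whereas removing \<open>y\<close> first leaves \<open>jw x\<close> alone, so the two orders differ
  by exactly one sign. For \<open>x = y\<close> both sides vanish, since a mode cannot be filled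
  twice.\<close>

lemma anticommute_cre_cre:
  assumes "finite M"
  shows "op_mult M (cre M x) (cre M y) = op_scale (-1) (op_mult M (cre M y) (cre M x))"
proof (intro ext)
  fix S U
  have *: "op_mult M (cre M x) (cre M y) S U
      = (if x \<in> S \<and> y \<in> S \<and> x \<noteq> y \<and> S \<subseteq> M \<and> U = S - {x, y} then jw x S * jw y (S - {x}) else 0)" for x y
    using assms by (auto simp: cre_mult cre_apply)
  have "jw x S * jw y (S - {x}) = - (jw y S * jw x (S - {y}))" if "S \<subseteq> M" "x \<in> S" "y \<in> S" "x \<noteq> y"
  proof -
    have "finite S" using that assms finite_subset by blast
    then show ?thesis using that by (cases "x < y") (auto simp: jw_remove)
  qed
  moreover have "{x, y} = {y, x}" by auto
  ultimately show "op_mult M (cre M x) (cre M y) S U = op_scale (-1) (op_mult M (cre M y) (cre M x)) S U"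
    unfolding op_scale_def * by auto
qed

text \<open>On equal modes every basis state admits exactly one of the two products, and its sign
  squares to 1. On distinct modes both products connect the same states, and one sign flips between
  the orders.\<close>

lemma anticommute_ann_cre:
  assumes "finite M" "x \<in> M" "y \<in> M"
  shows "op_mult M (ann M x) (cre M y)
    = op_add (op_scale (if x = y then 1 else 0) (op_one M)) (op_scale (-1) (op_mult M (cre M y) (ann M x)))"
proof (intro ext)
  fix S U
  have fin: "finite S" if "S \<subseteq> M" for S using that assms finite_subset by blast
  show "op_mult M (ann M x) (cre M y) S U
    = op_add (op_scale (if x = y then 1 else 0) (op_one M)) (op_scale (-1) (op_mult M (cre M y) (ann M x))) S U"
  proof (cases "x = y")
    case True
    have *: "insert y (U - {y}) = U" if "y \<in> U" using that by auto
    have "S = U" if "y \<in> S" "y \<in> U" "S - {y} = U - {y}" using that by blast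
    then show ?thesis using True fin assms
      by (auto simp: op_scale_def op_add_def op_one_def cre_mult ann_mult cre_apply ann_apply jw_insert jw_remove insert_absorb)
  next
    case False
    \<comment> \<open>For distinct modes, either order has a non-zero entry only if \<open>U\<close>
      is \<open>S\<close> with \<open>y\<close> traded for \<open>x\<close>.\<close>
    show ?thesis
    proof (cases "x \<notin> S \<and> y \<in> S \<and> S \<subseteq> M \<and> U = insert x S - {y}")
      case True
      then have "U - {x} = S - {y}" "x \<in> U" "U \<subseteq> M" using False assms by auto
      moreover have "U = insert x (S - {y})" using True False by auto
      ultimately show ?thesis using True False fin[of S] assms
        by (auto simp: op_scale_def op_add_def cre_mult ann_mult cre_apply ann_apply jw_insert jw_remove)
    next
      case F: False
      have "\<not> (y \<in> S \<and> S \<subseteq> M \<and> x \<in> U \<and> S - {y} = U - {x})"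
      proof
        assume A: "y \<in> S \<and> S \<subseteq> M \<and> x \<in> U \<and> S - {y} = U - {x}"
        then have "x \<notin> S" using False by blast
        moreover have "y \<notin> U" using A False by blast
        ultimately show False using A F False by blast
      qed
      then have "op_mult M (cre M y) (ann M x) S U = 0"
        using assms by (auto simp: cre_mult ann_apply)
      moreover have "op_mult M (ann M x) (cre M y) S U = 0"
        using assms F False by (auto simp: ann_mult cre_apply)
      ultimately show ?thesis using False by (simp add: op_scale_def op_add_def)
    qed
  qed
qed

section \<open>Exponentials\<close>

lemma is_op_pow [simp]: "is_op M X \<Longrightarrow> is_op M (op_pow M X n)"
  by (induction n) auto

text \<open>The sum of the moduli of all entries dominates every row sum, so each further factor
  \<open>X\<close> costs at most one such factor. This geometric growth makes the exponential series
  converge absolutely.\<close>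

lemma norm_op_pow_le:
  assumes "finite M" "is_op M X"
  shows "norm (op_pow M X n S T) \<le> (\<Sum>A\<in>Pow M. \<Sum>B\<in>Pow M. norm (X A B)) ^ n" (is "_ \<le> ?K ^ n")
proof (induction n arbitrary: S)
  case 0
  show ?case by (simp add: op_one_def)
next
  case (Suc n)
  have K: "0 \<le> ?K" by (intro sum_nonneg) simp
  \<comment> \<open>Only rows inside \<open>M\<close> enter the bounding sum; every other row of the
    power is zero.\<close>
  show ?case
  proof (cases "S \<subseteq> M")
    case True
    have "norm (op_pow M X (Suc n) S T) \<le> (\<Sum>B\<in>Pow M. norm (X S B) * norm (op_pow M X n B T))"
      by (simp add: op_mult_def order_trans[OF norm_sum] norm_mult)
    also have "\<dots> \<le> (\<Sum>B\<in>Pow M. norm (X S B) * ?K ^ n)"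
      by (intro sum_mono mult_left_mono Suc.IH) auto
    also have "\<dots> = (\<Sum>B\<in>Pow M. norm (X S B)) * ?K ^ n"
      by (simp add: sum_distrib_right)
    also have "\<dots> \<le> ?K * ?K ^ n"
      using True assms(1) K
      by (intro mult_right_mono member_le_sum[of S "Pow M" "\<lambda>A. \<Sum>B\<in>Pow M. norm (X A B)"] sum_nonneg) auto
    finally show ?thesis by simp
  next
    case False
    then have "op_pow M X (Suc n) S T = 0"
      using assms(2) is_op_pow[OF assms(2), of "Suc n"] unfolding is_op_def by blast
    then show ?thesis using K by simp
  qed
qed

lemma summable_op_exp:
  assumes "finite M" "is_op M X"
  shows "summable (\<lambda>n. norm (op_pow M X n S T / of_nat (fact n)))"
proof (rule summable_comparison_test')
  let ?K = "\<Sum>A\<in>Pow M. \<Sum>B\<in>Pow M. norm (X A B)"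
  show "summable (\<lambda>n. inverse (fact n) * ?K ^ n)"
    by (rule summable_exp)
  show "norm (norm (op_pow M X n S T / of_nat (fact n))) \<le> inverse (fact n) * ?K ^ n" for n
  proof -
    have "norm (norm (op_pow M X n S T / of_nat (fact n))) = norm (op_pow M X n S T) / fact n"
      by (simp add: norm_divide)
    also have "\<dots> \<le> ?K ^ n / fact n"
      by (intro divide_right_mono norm_op_pow_le assms) simp
    finally show ?thesis by (simp add: field_simps)
  qed
qed

lemma exp_sums: "(\<lambda>n. z ^ n / of_nat (fact n)) sums exp (z::complex)"
  using exp_converges[of z] by (simp add: scaleR_conv_of_real field_simps)

lemma op_exp_diag:
  assumes "finite M" "\<And>S T. X S T = (if S = T \<and> S \<subseteq> M then d S else 0)"
  shows "op_exp M X S T = (if S = T \<and> S \<subseteq> M then exp (d S) else 0)"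
proof -
  have pow: "op_pow M X n S T = (if S = T \<and> S \<subseteq> M then d S ^ n else 0)" for n S T
  proof (induction n arbitrary: S)
    case (Suc n)
    have "op_pow M X (Suc n) S T = (\<Sum>R\<in>Pow M. if R = S then d R * op_pow M X n R T else 0)"
      unfolding op_pow.simps op_mult_def by (intro sum.cong) (auto simp: assms(2))
    also have "\<dots> = (if S = T \<and> S \<subseteq> M then d S ^ Suc n else 0)"
      using assms(1) by (simp add: Suc)
    finally show ?case .
  qed (auto simp: op_one_def)
  show ?thesis
  proof (cases "S = T \<and> S \<subseteq> M")
    case True
    then show ?thesis
      using sums_unique[OF exp_sums[of "d S"]] by (simp add: op_exp_def pow)
  next
    case False
    then have "op_pow M X n S T = 0" for n by (simp only: pow if_False)
    with False show ?thesis unfolding op_exp_def by auto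
  qed
qed

lemma number_op_apply:
  assumes "finite M"
  shows "number_op M S T = (if S = T \<and> S \<subseteq> M then of_nat (card S) else 0)"
proof -
  have *: "op_mult M (cre M i) (ann M i) S T = (if i \<in> S then if S = T \<and> S \<subseteq> M then 1 else 0 else 0)"
    if "i \<in> M" for i
  proof (cases "i \<in> S \<and> i \<in> T \<and> S - {i} = T - {i}")
    case True
    then have "S = T" by blast
    then show ?thesis using assms that True by (auto simp: cre_mult ann_apply)
  next
    case False
    then show ?thesis using assms that by (auto simp: cre_mult ann_apply)
  qed
  have "number_op M S T = (\<Sum>i\<in>M. if i \<in> S then if S = T \<and> S \<subseteq> M then 1 else 0 else 0)"
    unfolding number_op_def op_sum_def using * by (intro sum.cong) auto
  also have "\<dots> = (if S = T \<and> S \<subseteq> M then of_nat (card S) else 0)"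
    using assms by (auto simp: Int_absorb1 sum.If_cases simp flip: sum.inter_restrict)
  finally show ?thesis .
qed

lemma parity_op_apply:
  assumes "finite M"
  shows "parity_op M S T = (if S = T \<and> S \<subseteq> M then (-1) ^ card S else 0)"
proof -
  have "exp (\<i> * of_real pi * of_nat n) = (-1) ^ n" for n
    by (metis exp_of_nat2_mult exp_pi_i')
  then show ?thesis
    unfolding parity_op_def
    by (subst op_exp_diag[OF assms, where d = "\<lambda>S. \<i> * of_real pi * of_nat (card S)"])
      (auto simp: op_scale_def number_op_apply[OF assms])
qed

text \<open>In divided powers, \<open>X\<^sup>n C\<close> is the Cauchy product of \<open>C X\<^sup>i\<close> and \<open>l\<^sup>j\<close>.\<close>

lemma op_exp_intertwine:
  assumes M: "finite M" and X: "is_op M X" and C: "is_op M C"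
    and comm: "op_mult M X C = op_add (op_mult M C X) (op_scale l C)"
  shows "op_mult M (op_exp M X) C = op_scale (exp l) (op_mult M C (op_exp M X))"
proof (intro ext)
  fix S U
  define q where "q i S U = op_mult M C (op_pow M X i) S U / of_nat (fact i)" for i S U
  define b where "b j = l ^ j / of_nat (fact j)" for j
  have fact_step: "of_nat (Suc n) * (z / of_nat (fact (Suc n))) = z / of_nat (fact n)" for n and z :: complex
    unfolding fact_Suc of_nat_mult of_nat_id by (simp del: of_nat_Suc)
  have Xq: "(\<Sum>T\<in>Pow M. X S T * q i T U) = of_nat (Suc i) * q (Suc i) S U + l * q i S U" for i S U
  proof -
    have "(\<Sum>T\<in>Pow M. X S T * q i T U) = op_mult M X (op_mult M C (op_pow M X i)) S U / of_nat (fact i)"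
      by (simp add: q_def op_mult_def[of M X] sum_divide_distrib)
    also have "op_mult M X (op_mult M C (op_pow M X i))
        = op_add (op_mult M C (op_pow M X (Suc i))) (op_scale l (op_mult M C (op_pow M X i)))"
      by (simp add: comm op_mult_linear M flip: op_mult_assoc)
    finally show ?thesis
      using fact_step[of i "op_mult M C (op_pow M X (Suc i)) S U"]
      by (simp add: q_def op_add_def op_scale_def add_divide_distrib del: op_pow.simps of_nat_Suc fact_Suc)
  qed
  have lb: "l * b j = of_nat (Suc j) * b (Suc j)" for j
    unfolding b_def fact_step by simp
  \<comment> \<open>The binomial formula for \<open>X ^ n C\<close> in divided powers. After
    multiplication by \<open>n + 1\<close>, one more \<open>X\<close> raises either the index of
    \<open>q\<close> or that of \<open>b\<close>; the resulting weights \<open>i\<close> and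
    \<open>n + 1 - i\<close> add up to \<open>n + 1\<close>.\<close>
  have pq: "op_mult M (op_pow M X n) C S U / of_nat (fact n) = (\<Sum>i\<le>n. q i S U * b (n - i))" for n S U
  proof (induction n arbitrary: S U)
    case 0
    show ?case using M C by (simp add: q_def b_def op_mult_one_left op_mult_one_right)
  next
    case (Suc n)
    have "of_nat (Suc n) * (op_mult M (op_pow M X (Suc n)) C S U / of_nat (fact (Suc n)))
        = op_mult M X (op_mult M (op_pow M X n) C) S U / of_nat (fact n)"
      unfolding fact_step by (simp add: op_mult_assoc M)
    also have "\<dots> = (\<Sum>T\<in>Pow M. X S T * (op_mult M (op_pow M X n) C T U / of_nat (fact n)))"
      by (simp add: op_mult_def[of M X] sum_divide_distrib)
    also have "\<dots> = (\<Sum>i\<le>n. (\<Sum>T\<in>Pow M. X S T * q i T U) * b (n - i))"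
      unfolding Suc.IH by (simp add: sum_distrib_left sum_distrib_right mult.assoc) (rule sum.swap)
    also have "\<dots> = (\<Sum>i\<le>n. of_nat (Suc i) * q (Suc i) S U * b (n - i)) + (\<Sum>i\<le>n. q i S U * (l * b (n - i)))"
      by (simp add: Xq algebra_simps sum.distrib)
    also have "(\<Sum>i\<le>n. of_nat (Suc i) * q (Suc i) S U * b (n - i))
        = (\<Sum>i\<le>Suc n. of_nat i * (q i S U * b (Suc n - i)))"
      by (subst sum.atMost_Suc_shift) (simp add: mult.assoc)
    also have "(\<Sum>i\<le>n. q i S U * (l * b (n - i)))
        = (\<Sum>i\<le>Suc n. of_nat (Suc n - i) * (q i S U * b (Suc n - i)))"
      by (auto simp: lb Suc_diff_le intro!: sum.cong)
    also have "(\<Sum>i\<le>Suc n. of_nat i * (q i S U * b (Suc n - i))) + \<dots>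
        = (\<Sum>i\<le>Suc n. of_nat (Suc n) * (q i S U * b (Suc n - i)))"
      unfolding sum.distrib[symmetric] distrib_right[symmetric]
      by (intro sum.cong) (simp_all flip: of_nat_add)
    also have "\<dots> = of_nat (Suc n) * (\<Sum>i\<le>Suc n. q i S U * b (Suc n - i))"
      by (rule sum_distrib_left[symmetric])
    finally show ?case by (simp only: mult_cancel_left of_nat_eq_0_iff nat.distinct simp_thms)
  qed
  have entry: "(\<lambda>n. op_pow M X n S T / of_nat (fact n)) sums op_exp M X S T" for S T
    unfolding op_exp_def by (rule summable_sums, rule summable_norm_cancel, rule summable_op_exp[OF M X])
  have left: "(\<lambda>n. op_mult M (op_pow M X n) C S U / of_nat (fact n)) sums op_mult M (op_exp M X) C S U"
    unfolding op_mult_def sum_divide_distrib times_divide_eq_left[symmetric]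
    by (intro sums_sum sums_mult2 entry[unfolded times_divide_eq_left[symmetric]])
  have qs: "(\<lambda>n. q n S U) sums op_mult M C (op_exp M X) S U"
    unfolding q_def op_mult_def sum_divide_distrib times_divide_eq_right[symmetric]
    by (intro sums_sum sums_mult entry)
  \<comment> \<open>The Cauchy product of the two series is justified by their absolute
    convergence.\<close>
  have qn: "summable (\<lambda>n. norm (q n S U))"
  proof (rule summable_comparison_test')
    show "summable (\<lambda>n. \<Sum>T\<in>Pow M. norm (C S T) * norm (op_pow M X n T U / of_nat (fact n)))"
      by (intro summable_sum summable_mult summable_op_exp[OF M X])
    show "norm (norm (q n S U)) \<le> (\<Sum>T\<in>Pow M. norm (C S T) * norm (op_pow M X n T U / of_nat (fact n)))" for n
      unfolding q_def op_mult_def sum_divide_distrib times_divide_eq_right[symmetric] norm_mult[symmetric]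
      real_norm_def abs_norm_cancel by (rule norm_sum)
  qed
  have bn: "summable (\<lambda>n. norm (b n))"
    unfolding b_def using summable_norm_exp[of l] by (simp add: scaleR_conv_of_real field_simps norm_divide)
  have "(\<lambda>n. \<Sum>i\<le>n. q i S U * b (n - i)) sums ((\<Sum>n. q n S U) * (\<Sum>n. b n))"
    by (rule Cauchy_product_sums[OF qn bn])
  moreover have "(\<Sum>n. b n) = exp l"
    unfolding b_def by (rule sums_unique[OF exp_sums, symmetric])
  ultimately have "(\<lambda>n. op_mult M (op_pow M X n) C S U / of_nat (fact n)) sums
      (op_mult M C (op_exp M X) S U * exp l)"
    unfolding pq sums_unique[OF qs, symmetric] by simp
  with left have "op_mult M (op_exp M X) C S U = op_mult M C (op_exp M X) S U * exp l"
    by (rule sums_unique2)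
  then show "op_mult M (op_exp M X) C S U = op_scale (exp l) (op_mult M C (op_exp M X)) S U"
    by (simp add: op_scale_def)
qed

text \<open>An operator that annihilates the vacuum leaves only the zeroth term of its exponential
  series there.\<close>

lemma op_exp_vacuum:
  assumes "finite M" "\<And>S. X S {} = 0"
  shows "op_exp M X S {} = (if S = {} then 1 else 0)"
proof -
  have *: "op_pow M X (Suc n) S {} = 0" for n S
  proof (induction n arbitrary: S)
    case 0
    show ?case
      using assms by (simp add: op_mult_def op_one_def) (subst sum_eq_single[of _ "{}"]; auto)
  next
    case (Suc n)
    then show ?case by (simp add: op_mult_def[of M X "op_mult M X (op_pow M X n)"])
  qed
  have "op_pow M X n S {} / of_nat (fact n) = (if n = 0 then op_one M S {} else 0)" for n
    using * by (cases n) (auto simp del: op_pow.simps(2))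
  then have "op_exp M X S {} = op_one M S {}"
    using sums_unique[OF sums_single[of 0 "\<lambda>_. op_one M S {}"]] by (simp add: op_exp_def)
  then show ?thesis by (simp add: op_one_def)
qed

section \<open>The time translation operator\<close>

lemma finite_modes_H [simp]: "finite (modes_H N L)"
  by (simp add: modes_H_def)

text \<open>The terms are powers of an \<open>N\<close>-th root of unity. It equals 1 only if
  \<open>N\<close> divides \<open>d\<close>, which the bound on \<open>d\<close> allows only for
  \<open>d = 0\<close>; otherwise the geometric sum vanishes.\<close>

lemma sum_roots_of_unity:
  fixes d :: int
  assumes "\<bar>d\<bar> < int N"
  shows "(\<Sum>t<N. exp (2 * of_real pi * \<i> * of_int d * of_nat t / of_nat N)) = (if d = 0 then of_nat N else 0)"
proof (cases "d = 0")
  case False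
  define z where "z = exp (2 * of_real pi * \<i> * of_int d / of_nat N)"
  have N: "N > 0" using assms by (cases N) auto
  have "z \<noteq> 1"
  proof
    assume "z = 1"
    then obtain n :: int where "2 * of_real pi * \<i> * of_int d / of_nat N = of_int (2 * n) * of_real pi * \<i>"
      unfolding z_def exp_eq_1 by (auto simp: complex_eq_iff)
    then have "(of_int d :: complex) = of_int (n * int N)"
      using N by (auto simp: field_simps)
    then have "d = n * int N" by (simp only: of_int_eq_iff)
    with assms False N show False
      by (cases "n = 0") (auto simp: abs_mult mult_le_cancel_right1 not_less)
  qed
  have zt: "exp (2 * of_real pi * \<i> * of_int d * of_nat t / of_nat N) = z ^ t" for t
    unfolding z_def exp_of_nat_mult[symmetric] by (simp add: mult_ac)
  have "z ^ N = exp (2 * of_real pi * \<i> * of_int d)"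
    using N by (simp flip: zt)
  also have "\<dots> = 1"
    unfolding exp_eq_1 by auto
  finally have "(\<Sum>t<N. z ^ t) = 0"
    using \<open>z \<noteq> 1\<close> by (simp add: geometric_sum)
  with False show ?thesis by (simp add: zt)
qed simp

text \<open>The Fourier coefficient at frequency \<open>omega \<epsilon> N n\<close> and time
  \<open>t\<close>, from which \<epsilon> cancels. The odd numerator makes it antiperiodic in
  \<open>t\<close> with period \<open>N\<close>.\<close>

definition phase :: "nat \<Rightarrow> nat \<Rightarrow> nat \<Rightarrow> complex" where
  "phase N n t = exp (of_real pi * \<i> * of_nat (2 * n + 1) * of_nat t / of_nat N)"

lemma exp_omega:
  assumes "\<epsilon> > 0"
  shows "exp (\<i> * of_real (omega \<epsilon> N n * \<epsilon> * real t)) = phase N n t"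
    and "exp (\<i> * of_real \<epsilon> * of_real (omega \<epsilon> N n)) = phase N n 1"
proof -
  have *: "omega \<epsilon> N n * \<epsilon> = pi * real (2 * n + 1) / real N"
    using assms by (simp add: omega_def mult.commute)
  show "exp (\<i> * of_real (omega \<epsilon> N n * \<epsilon> * real t)) = phase N n t"
    unfolding * phase_def by (simp add: mult_ac)
  have "\<i> * of_real \<epsilon> * of_real (omega \<epsilon> N n) = \<i> * of_real (omega \<epsilon> N n * \<epsilon>)"
    by (simp add: mult_ac)
  then show "exp (\<i> * of_real \<epsilon> * of_real (omega \<epsilon> N n)) = phase N n 1"
    unfolding * phase_def by (simp add: mult_ac)
qed

lemma cnj_phase: "cnj (phase N n t) = exp (- (of_real pi * \<i> * of_nat (2 * n + 1) * of_nat t / of_nat N))"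
  by (simp add: phase_def exp_cnj)

text \<open>The half-integer offsets of the two frequencies cancel in \<open>m - n\<close>, leaving
  a plain sum of roots of unity.\<close>

lemma phase_orthogonal_time:
  assumes "m < N" "n < N"
  shows "(\<Sum>t<N. phase N m t * cnj (phase N n t)) = (if m = n then of_nat N else 0)"
proof -
  have "phase N m t * cnj (phase N n t) = exp (2 * of_real pi * \<i> * of_int (int m - int n) * of_nat t / of_nat N)" for t
    unfolding cnj_phase unfolding phase_def exp_add[symmetric]
    by (rule arg_cong[where f = exp]) (use assms in \<open>simp add: field_simps\<close>)
  then show ?thesis
    using sum_roots_of_unity[of "int m - int n" N] assms by simp
qed

text \<open>Here the half-integer offset survives as a prefactor depending on \<open>t - u\<close>
  only. It multiplies a sum that vanishes unless \<open>t = u\<close>, and there the prefactor is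
  1.\<close>

lemma phase_orthogonal_frequency:
  assumes "t < N" "u < N"
  shows "(\<Sum>n<N. phase N n t * cnj (phase N n u)) = (if t = u then of_nat N else 0)"
proof -
  have "phase N n t * cnj (phase N n u) = exp (of_real pi * \<i> * of_int (int t - int u) / of_nat N)
      * exp (2 * of_real pi * \<i> * of_int (int t - int u) * of_nat n / of_nat N)" for n
    unfolding cnj_phase unfolding phase_def exp_add[symmetric]
    by (rule arg_cong[where f = exp]) (use assms in \<open>simp add: field_simps\<close>)
  then show ?thesis
    using sum_roots_of_unity[of "int t - int u" N] assms by (auto simp flip: sum_distrib_left)
qed

lemma phase_Suc: "phase N n t * phase N n 1 = phase N n (Suc t)"
  unfolding phase_def exp_add[symmetric]
  by (rule arg_cong[where f = exp]) (simp add: add_divide_distrib algebra_simps)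

lemma phase_antiperiodic: "N > 0 \<Longrightarrow> phase N n N = - 1"
proof -
  assume "N > 0"
  then have "phase N n N = exp (of_nat (2 * n + 1) * (of_real pi * \<i>))"
    unfolding phase_def by (simp add: mult_ac)
  also have "\<dots> = (-1) ^ (2 * n + 1)"
    unfolding exp_of_nat_mult by simp
  finally show ?thesis by simp
qed

section \<open>Anticommutation relations of the Fourier modes\<close>

lemma ahat_phase:
  assumes "\<epsilon> > 0"
  shows "ahat \<epsilon> N L n i = op_scale (of_real (1 / sqrt (real N)))
    (op_sum (\<lambda>t. op_scale (phase N n t) (ann (modes_H N L) (t, i))) {0..<N})"
  unfolding ahat_def exp_omega(1)[OF assms] ..

lemma adj_ahat_phase:
  assumes "\<epsilon> > 0"
  shows "op_adj (ahat \<epsilon> N L n i) = op_scale (of_real (1 / sqrt (real N)))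
    (op_sum (\<lambda>t. op_scale (cnj (phase N n t)) (cre (modes_H N L) (t, i))) {0..<N})"
  unfolding ahat_phase[OF assms] by (simp add: op_adj_scale op_adj_sum cre_def)

lemma is_op_ahat [simp]: "is_op (modes_H N L) (ahat \<epsilon> N L n i)"
  unfolding ahat_def by simp

lemma is_op_calP [simp]: "is_op (modes_H N L) (calP \<epsilon> N L)"
  unfolding calP_def by (intro is_op_sum) auto

text \<open>The phases divided by \<open>sqrt N\<close> form a unitary matrix, so the Fourier modes
  inherit the canonical relations of the time modes.\<close>

lemma anticommute_ahat_adj_ahat:
  assumes "\<epsilon> > 0" "m < N" "n < N" "i \<in> {1..L}" "j \<in> {1..L}"
  shows "op_mult (modes_H N L) (ahat \<epsilon> N L m i) (op_adj (ahat \<epsilon> N L n j))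
    = op_add (op_scale (if (m, i) = (n, j) then 1 else 0) (op_one (modes_H N L)))
        (op_scale (-1) (op_mult (modes_H N L) (op_adj (ahat \<epsilon> N L n j)) (ahat \<epsilon> N L m i)))"
proof (intro ext)
  fix S U
  let ?M = "modes_H N L"
  define r where "r = complex_of_real (1 / sqrt (real N))"
  note fourier = adj_ahat_phase[OF assms(1), of N, folded r_def] ahat_phase[OF assms(1), of N, folded r_def]
  have N: "N > 0" using assms by simp
  have rr: "r * r = 1 / of_nat N"
    by (simp add: r_def flip: of_real_mult)
  have car: "op_mult ?M (ann ?M (t, i)) (cre ?M (u, j)) S U
      = (if (t, i) = (u, j) then op_one ?M S U else 0) - op_mult ?M (cre ?M (u, j)) (ann ?M (t, i)) S U"
    if "t < N" "u < N" for t u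
    using anticommute_ann_cre[of ?M "(t, i)" "(u, j)"] that assms
    by (simp add: modes_H_def op_add_def op_scale_def)
  have "op_mult ?M (ahat \<epsilon> N L m i) (op_adj (ahat \<epsilon> N L n j)) S U
      = r * r * (\<Sum>t<N. \<Sum>u<N. phase N m t * cnj (phase N n u) * op_mult ?M (ann ?M (t, i)) (cre ?M (u, j)) S U)"
    unfolding fourier(1) unfolding fourier(2) op_mult_linear
    by (simp add: op_scale_def op_sum_def sum_distrib_left mult_ac atLeast0LessThan) (rule sum.swap)
  also have "\<dots> = r * r * ((\<Sum>t<N. \<Sum>u<N. phase N m t * cnj (phase N n u) * (if (t, i) = (u, j) then op_one ?M S U else 0))
      - (\<Sum>t<N. \<Sum>u<N. phase N m t * cnj (phase N n u) * op_mult ?M (cre ?M (u, j)) (ann ?M (t, i)) S U))"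
    by (simp add: car right_diff_distrib sum_subtractf)
  also have "\<dots> = r * r * (\<Sum>t<N. \<Sum>u<N. phase N m t * cnj (phase N n u) * (if (t, i) = (u, j) then op_one ?M S U else 0))
      - r * r * (\<Sum>t<N. \<Sum>u<N. phase N m t * cnj (phase N n u) * op_mult ?M (cre ?M (u, j)) (ann ?M (t, i)) S U)"
    by (rule right_diff_distrib)
  also have "(\<Sum>t<N. \<Sum>u<N. phase N m t * cnj (phase N n u) * (if (t, i) = (u, j) then op_one ?M S U else 0))
      = (\<Sum>t<N. phase N m t * cnj (phase N n t)) * (if i = j then op_one ?M S U else 0)"
    by (simp add: sum_distrib_right if_distrib[of "\<lambda>x. _ * x"] cong: if_cong)
  also have "r * r * \<dots> = (if (m, i) = (n, j) then op_one ?M S U else 0)"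
    unfolding rr phase_orthogonal_time[OF assms(2,3)] using N by simp
  also have "r * r * (\<Sum>t<N. \<Sum>u<N. phase N m t * cnj (phase N n u) * op_mult ?M (cre ?M (u, j)) (ann ?M (t, i)) S U)
      = op_mult ?M (op_adj (ahat \<epsilon> N L n j)) (ahat \<epsilon> N L m i) S U"
    unfolding fourier(1) unfolding fourier(2) op_mult_linear
    by (simp add: op_scale_def op_sum_def sum_distrib_left mult_ac atLeast0LessThan)
  finally show "op_mult ?M (ahat \<epsilon> N L m i) (op_adj (ahat \<epsilon> N L n j)) S U
    = op_add (op_scale (if (m, i) = (n, j) then 1 else 0) (op_one ?M))
        (op_scale (-1) (op_mult ?M (op_adj (ahat \<epsilon> N L n j)) (ahat \<epsilon> N L m i))) S U"
    by (simp add: op_add_def op_scale_def)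
qed

lemma anticommute_adj_ahat_adj_ahat:
  assumes "\<epsilon> > 0"
  shows "op_mult (modes_H N L) (op_adj (ahat \<epsilon> N L m i)) (op_adj (ahat \<epsilon> N L n j))
    = op_scale (-1) (op_mult (modes_H N L) (op_adj (ahat \<epsilon> N L n j)) (op_adj (ahat \<epsilon> N L m i)))"
proof (intro ext)
  fix S U
  let ?M = "modes_H N L"
  define r where "r = complex_of_real (1 / sqrt (real N))"
  have car: "op_mult ?M (cre ?M (t, i)) (cre ?M (u, j)) S U = - op_mult ?M (cre ?M (u, j)) (cre ?M (t, i)) S U" for t u
    using anticommute_cre_cre[of ?M "(t, i)" "(u, j)"] by (simp add: op_scale_def)
  show "op_mult ?M (op_adj (ahat \<epsilon> N L m i)) (op_adj (ahat \<epsilon> N L n j)) S U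
    = op_scale (-1) (op_mult ?M (op_adj (ahat \<epsilon> N L n j)) (op_adj (ahat \<epsilon> N L m i))) S U"
    unfolding adj_ahat_phase[OF assms, of N, folded r_def] op_mult_linear
    by (simp add: op_scale_def op_sum_def car sum_distrib_left sum_negf mult_ac) (rule sum.swap)
qed

text \<open>Carrying the creator past the number operator of a Fourier mode changes sign twice and
  leaves one contraction, which is present only for the same mode. Hence the creator raises the
  eigenvalue of \<open>calP\<close> by its own frequency.\<close>

lemma commutator_calP_adj_ahat:
  assumes "\<epsilon> > 0" "n < N" "j \<in> {1..L}"
  shows "op_mult (modes_H N L) (calP \<epsilon> N L) (op_adj (ahat \<epsilon> N L n j))
    = op_add (op_mult (modes_H N L) (op_adj (ahat \<epsilon> N L n j)) (calP \<epsilon> N L))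
        (op_scale (of_real (omega \<epsilon> N n)) (op_adj (ahat \<epsilon> N L n j)))"
proof -
  let ?M = "modes_H N L"
  let ?a = "\<lambda>m i. ahat \<epsilon> N L m i"
  let ?c = "\<lambda>m i. op_adj (ahat \<epsilon> N L m i)"
  have step: "op_mult ?M (op_mult ?M (?c m i) (?a m i)) (?c n j)
      = op_add (op_scale (if (m, i) = (n, j) then 1 else 0) (?c m i))
          (op_mult ?M (?c n j) (op_mult ?M (?c m i) (?a m i)))"
    if "m < N" "i \<in> {1..L}" for m i
  proof -
    have "op_mult ?M (op_mult ?M (?c m i) (?a m i)) (?c n j) = op_mult ?M (?c m i) (op_mult ?M (?a m i) (?c n j))"
      by (simp add: op_mult_assoc)
    also have "\<dots> = op_add (op_scale (if (m, i) = (n, j) then 1 else 0) (?c m i))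
        (op_scale (-1) (op_mult ?M (op_mult ?M (?c m i) (?c n j)) (?a m i)))"
      unfolding anticommute_ahat_adj_ahat[OF assms(1) that(1) assms(2) that(2) assms(3)]
      by (simp add: op_mult_linear op_mult_one_right op_mult_assoc)
    also have "op_mult ?M (?c m i) (?c n j) = op_scale (-1) (op_mult ?M (?c n j) (?c m i))"
      by (rule anticommute_adj_ahat_adj_ahat[OF assms(1)])
    finally show ?thesis
      by (simp add: op_mult_linear op_mult_assoc op_scale_scale)
  qed
  show ?thesis
  proof (intro ext)
    fix S U
    have "op_mult ?M (calP \<epsilon> N L) (?c n j) S U
        = (\<Sum>(m, i)\<in>{0..<N} \<times> {1..L}. of_real (omega \<epsilon> N m) * op_mult ?M (op_mult ?M (?c m i) (?a m i)) (?c n j) S U)"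
      unfolding calP_def split_def op_mult_linear by (simp add: op_sum_def op_scale_def)
    also have "\<dots> = (\<Sum>(m, i)\<in>{0..<N} \<times> {1..L}. (if (m, i) = (n, j) then of_real (omega \<epsilon> N n) * ?c n j S U else 0)
        + of_real (omega \<epsilon> N m) * op_mult ?M (?c n j) (op_mult ?M (?c m i) (?a m i)) S U)"
      by (intro sum.cong) (auto simp: step op_add_def op_scale_def algebra_simps)
    also have "\<dots> = (\<Sum>x\<in>{0..<N} \<times> {1..L}. if x = (n, j) then of_real (omega \<epsilon> N n) * ?c n j S U else 0)
        + op_mult ?M (?c n j) (calP \<epsilon> N L) S U"
      unfolding calP_def split_def op_mult_linear prod.collapse by (simp add: op_sum_def op_scale_def sum.distrib)
    finally show "op_mult ?M (calP \<epsilon> N L) (?c n j) S U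
      = op_add (op_mult ?M (?c n j) (calP \<epsilon> N L)) (op_scale (of_real (omega \<epsilon> N n)) (?c n j)) S U"
      using assms by (simp add: op_add_def op_scale_def)
  qed
qed

section \<open>Time translation in the occupation-number basis\<close>

definition transl :: "real \<Rightarrow> nat \<Rightarrow> nat \<Rightarrow> (nat \<times> nat) op" where
  "transl \<epsilon> N L = op_exp (modes_H N L) (op_scale (\<i> * of_real \<epsilon>) (calP \<epsilon> N L))"

text \<open>The commutator with the exponent is a scalar multiple of the creator, so
  \<open>op_exp_intertwine\<close> applies; the exponential of that scalar is the phase of one time
  step.\<close>

lemma transl_adj_ahat:
  assumes "\<epsilon> > 0" "n < N" "j \<in> {1..L}"
  shows "op_mult (modes_H N L) (transl \<epsilon> N L) (op_adj (ahat \<epsilon> N L n j))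
    = op_scale (phase N n 1) (op_mult (modes_H N L) (op_adj (ahat \<epsilon> N L n j)) (transl \<epsilon> N L))"
  unfolding transl_def exp_omega(2)[OF assms(1), symmetric]
proof (rule op_exp_intertwine)
  show "op_mult (modes_H N L) (op_scale (\<i> * of_real \<epsilon>) (calP \<epsilon> N L)) (op_adj (ahat \<epsilon> N L n j)) =
    op_add (op_mult (modes_H N L) (op_adj (ahat \<epsilon> N L n j)) (op_scale (\<i> * of_real \<epsilon>) (calP \<epsilon> N L)))
     (op_scale (\<i> * of_real \<epsilon> * of_real (omega \<epsilon> N n)) (op_adj (ahat \<epsilon> N L n j)))"
    unfolding op_mult_linear commutator_calP_adj_ahat[OF assms]
    by (simp add: op_add_def op_scale_def algebra_simps)
qed auto

text \<open>The inverse transform rests on orthogonality under summation over frequencies.\<close>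

lemma fourier_inverse:
  assumes "\<epsilon> > 0" "t < N"
  shows "cre (modes_H N L) (t, j)
    = op_scale (of_real (1 / sqrt (real N))) (op_sum (\<lambda>n. op_scale (phase N n t) (op_adj (ahat \<epsilon> N L n j))) {..<N})"
proof (intro ext)
  fix S U
  define r where "r = complex_of_real (1 / sqrt (real N))"
  let ?c = "\<lambda>u. cre (modes_H N L) (u, j) S U"
  have rr: "r * r = 1 / of_nat N"
    by (simp add: r_def flip: of_real_mult)
  have "op_scale r (op_sum (\<lambda>n. op_scale (phase N n t) (op_adj (ahat \<epsilon> N L n j))) {..<N}) S U
      = r * r * (\<Sum>n<N. \<Sum>u<N. phase N n t * cnj (phase N n u) * ?c u)"
    unfolding adj_ahat_phase[OF assms(1), of N, folded r_def]
    by (simp add: op_scale_def op_sum_def sum_distrib_left mult_ac atLeast0LessThan)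
  also have "(\<Sum>n<N. \<Sum>u<N. phase N n t * cnj (phase N n u) * ?c u)
      = (\<Sum>u<N. \<Sum>n<N. phase N n t * cnj (phase N n u) * ?c u)"
    by (rule sum.swap)
  also have "\<dots> = (\<Sum>u<N. (if t = u then of_nat N else 0) * ?c u)"
    using assms by (intro sum.cong) (simp_all add: phase_orthogonal_frequency flip: sum_distrib_right)
  also have "\<dots> = of_nat N * ?c t"
    using assms by (simp add: if_distrib[of "\<lambda>x. x * _"] cong: if_cong)
  finally show "?c t
    = op_scale (of_real (1 / sqrt (real N))) (op_sum (\<lambda>n. op_scale (phase N n t) (op_adj (ahat \<epsilon> N L n j))) {..<N}) S U"
    unfolding rr r_def[symmetric] using assms by simp
qed

text \<open>The cyclic shift of modes alone; the sign from antiperiodicity is recorded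
  separately.\<close>

definition next_mode :: "nat \<Rightarrow> nat \<times> nat \<Rightarrow> nat \<times> nat" where
  "next_mode N x = (if Suc (fst x) = N then 0 else Suc (fst x), snd x)"

text \<open>The one-step phase gained by each Fourier component turns the coefficients of time
  \<open>t\<close> into those of time \<open>t + 1\<close>. Leaving the last slice, the creator
  returns to slice 0 with a minus sign by antiperiodicity.\<close>

lemma transl_cre:
  assumes "\<epsilon> > 0" "x \<in> modes_H N L"
  shows "op_mult (modes_H N L) (transl \<epsilon> N L) (cre (modes_H N L) x)
    = op_scale (if Suc (fst x) = N then -1 else 1)
        (op_mult (modes_H N L) (cre (modes_H N L) (next_mode N x)) (transl \<epsilon> N L))"
proof -
  let ?M = "modes_H N L"
  obtain t j where x: "x = (t, j)" "t < N" "j \<in> {1..L}" using assms by (auto simp: modes_H_def)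
  \<comment> \<open>The Fourier sum makes sense at every \<open>t\<close>. At \<open>t = N\<close>
    it is no mode of the space, but minus the creator at time 0.\<close>
  define C where "C t = op_scale (of_real (1 / sqrt (real N)))
    (op_sum (\<lambda>n. op_scale (phase N n t) (op_adj (ahat \<epsilon> N L n j))) {..<N})" for t
  have C: "C u = cre ?M (u, j)" if "u < N" for u
    using fourier_inverse[OF assms(1) that] by (simp add: C_def)
  have "C N = op_scale (-1) (C 0)"
    using x by (simp add: C_def phase_antiperiodic phase_def[of _ _ 0] op_scale_def op_sum_def sum_negf)
  then have "C (Suc t) = op_scale (if Suc t = N then -1 else 1) (cre ?M (next_mode N x))"
    using x C[of 0] C[of "Suc t"] by (auto simp: next_mode_def)
  moreover have "op_mult ?M (transl \<epsilon> N L) (C t) = op_mult ?M (C (Suc t)) (transl \<epsilon> N L)"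
    unfolding C_def op_mult_linear using assms(1) x(3)
    by (intro arg_cong[where f = "op_scale _"] op_sum_cong)
      (simp add: transl_adj_ahat op_scale_scale phase_Suc del: One_nat_def)
  ultimately show ?thesis
    using C[OF x(2)] x(1) by (simp add: op_mult_linear)
qed

lemma transl_vacuum: "transl \<epsilon> N L S {} = (if S = {} then 1 else 0)"
  unfolding transl_def
proof (rule op_exp_vacuum)
  have "ahat \<epsilon> N L n j T {} = 0" for n j T
    by (simp add: ahat_def op_scale_def op_sum_def ann_apply)
  then show "op_scale (\<i> * of_real \<epsilon>) (calP \<epsilon> N L) S {} = 0" for S
    by (simp add: calP_def op_scale_def op_sum_def op_mult_def split_def)
qed simp

text \<open>Each particle leaving the last slice brings one sign from antiperiodicity and one for
  every particle on the other slices, which its creator must pass because slice 0 comes first in the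
  mode order.\<close>

definition transl_sign :: "nat \<Rightarrow> (nat \<times> nat) set \<Rightarrow> complex" where
  "transl_sign N S = (-1) ^ (card {x\<in>S. Suc (fst x) = N} * (1 + card {x\<in>S. Suc (fst x) \<noteq> N}))"

lemma inj_on_next_mode: "inj_on (next_mode N) (modes_H N L)"
  by (auto simp: inj_on_def next_mode_def modes_H_def prod_eq_iff split: if_splits)

lemma next_mode_in: "x \<in> modes_H N L \<Longrightarrow> next_mode N x \<in> modes_H N L"
  by (auto simp: next_mode_def modes_H_def)

text \<open>This is the sign produced when the creator of a new smallest mode is carried through the
  translation. If that mode is on the last slice, so is all of \<open>S\<close>, and no shifted mode
  lies below it; otherwise the shifted modes below it are exactly those that wrapped around.\<close>

lemma transl_sign_insert_min:
  assumes "finite S" "insert x S \<subseteq> modes_H N L" "\<forall>y\<in>S. x < y"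
  shows "transl_sign N (insert x S)
    = (if Suc (fst x) = N then -1 else 1) * jw (next_mode N x) (next_mode N ` S) * transl_sign N S"
proof (cases "Suc (fst x) = N")
  case True
  have last: "Suc (fst y) = N \<and> snd x < snd y" if "y \<in> S" for y
    using that assms True by (force simp: modes_H_def less_prod_def)
  then have "{z \<in> next_mode N ` S. z < next_mode N x} = {}"
    using True by (force simp: next_mode_def less_prod_def)
  then have "jw (next_mode N x) (next_mode N ` S) = 1"
    by (simp only: jw_def) simp
  moreover have eqs: "{y\<in>S. Suc (fst y) = N} = S" "{y\<in>insert x S. Suc (fst y) = N} = insert x S"
    "{y\<in>S. Suc (fst y) \<noteq> N} = {}" "{y\<in>insert x S. Suc (fst y) \<noteq> N} = {}"
    using last True by auto
  moreover have "x \<notin> S" using assms(3) by blast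
  ultimately show ?thesis
    unfolding transl_sign_def eqs using True assms(1) by simp
next
  case False
  have x: "x \<notin> S" using assms(3) by blast
  have "{z \<in> next_mode N ` S. z < next_mode N x} = next_mode N ` {y\<in>S. Suc (fst y) = N}"
    using assms(3) False by (force simp: next_mode_def less_prod_def)
  moreover have "inj_on (next_mode N) {y\<in>S. Suc (fst y) = N}"
    by (rule inj_on_subset[OF inj_on_next_mode[of N L]]) (use assms(2) in auto)
  ultimately have "jw (next_mode N x) (next_mode N ` S) = (-1) ^ card {y\<in>S. Suc (fst y) = N}"
    by (simp add: jw_def card_image)
  moreover have eqs: "{y\<in>insert x S. Suc (fst y) = N} = {y\<in>S. Suc (fst y) = N}"
    "{y\<in>insert x S. Suc (fst y) \<noteq> N} = insert x {y\<in>S. Suc (fst y) \<noteq> N}"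
    using False by auto
  ultimately show ?thesis
    unfolding transl_sign_def eqs using False assms(1) x by (simp add: power_add mult_ac)
qed

text \<open>A basis state is built from the vacuum by adding modes in decreasing order, so that each
  creator acts without Jordan-Wigner sign. \<open>transl_cre\<close> moves these creators out one by
  one until the translation meets the vacuum.\<close>

lemma transl_apply:
  assumes "\<epsilon> > 0" "S \<subseteq> modes_H N L"
  shows "transl \<epsilon> N L S' S = (if S' = next_mode N ` S then transl_sign N S else 0)"
proof -
  let ?M = "modes_H N L"
  have "finite S" using assms(2) by (rule finite_subset) simp
  then show ?thesis using assms(2)
  proof (induction S arbitrary: S' rule: finite_linorder_min_induct)
    case empty
    show ?case by (simp add: transl_vacuum transl_sign_def)
  next
    case (insert x S)
    let ?y = "next_mode N x"
    let ?s = "if Suc (fst x) = N then -1 else 1 :: complex"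
    have x: "x \<in> ?M" "x \<notin> S" "S \<subseteq> ?M" using insert by auto
    have "{j\<in>S. j < x} = {}" using insert.hyps by (auto dest: order.asym)
    then have "jw x S = 1" by (simp only: jw_def) simp
    then have "transl \<epsilon> N L S' (insert x S) = op_mult ?M (transl \<epsilon> N L) (cre ?M x) S' S"
      using x by (simp add: mult_cre)
    also have "\<dots> = ?s * op_mult ?M (cre ?M ?y) (transl \<epsilon> N L) S' S"
      unfolding transl_cre[OF assms(1) x(1)] by (simp add: op_scale_def)
    also have "\<dots> = (if S' = insert ?y (next_mode N ` S) then ?s * (jw ?y S' * transl_sign N S) else 0)"
    proof -
      have ny: "?y \<notin> next_mode N ` S"
        using x inj_on_next_mode[of N L] by (auto simp: inj_on_def)
      have sub: "insert ?y (next_mode N ` S) \<subseteq> ?M"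
        using x next_mode_in[of _ N L] by auto
      have "?y \<in> S' \<and> S' - {?y} = next_mode N ` S \<longleftrightarrow> S' = insert ?y (next_mode N ` S)"
        using ny by auto
      then show ?thesis
        using sub next_mode_in[OF x(1)] insert.IH[OF x(3)] by (auto simp: cre_mult)
    qed
    also have "\<dots> = (if S' = next_mode N ` insert x S then transl_sign N (insert x S) else 0)"
      using transl_sign_insert_min[OF insert.hyps(1) insert.prems] insert.hyps x
        inj_on_next_mode[of N L] by (auto simp: jw_insert)
    finally show ?case .
  qed
qed

section \<open>Slice operators\<close>

text \<open>The ladder operators generate the operator algebra: \<open>|\<emptyset>\<rangle>\<langle>\<emptyset>| = \<Prod>\<^sub>i a\<^sub>i a\<^sub>i\<^sup>\<dagger>\<close>, and creation operators
  carry it to all matrix units.\<close>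

lemma unital_star_hom_eqI:
  fixes \<phi> \<psi> :: "('a::linorder) op \<Rightarrow> 'b op"
  assumes A: "finite A" and \<phi>: "unital_star_hom A B \<phi>" and \<psi>: "unital_star_hom A B \<psi>"
    and ann: "\<And>i. i \<in> A \<Longrightarrow> \<phi> (ann A i) = \<psi> (ann A i)"
  shows "\<phi> = \<psi>"
proof -
  \<comment> \<open>The operators on which both homomorphisms agree are closed under all algebra
    operations; the goal is that they exhaust the algebra.\<close>
  define G where "G X \<longleftrightarrow> is_op A X \<and> \<phi> X = \<psi> X" for X
  have G_mult: "G (op_mult A X Y)" if "G X" "G Y" for X Y
    using that \<phi> \<psi> unfolding G_def unital_star_hom_def by simp
  have G_add: "G (op_add X Y)" if "G X" "G Y" for X Y
    using that \<phi> \<psi> unfolding G_def unital_star_hom_def by simp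
  have G_scale: "G (op_scale c X)" if "G X" for c X
    using that \<phi> \<psi> unfolding G_def unital_star_hom_def by simp
  have G_adj: "G (op_adj X)" if "G X" for X
    using that \<phi> \<psi> unfolding G_def unital_star_hom_def by simp
  have G_one: "G (op_one A)"
    using \<phi> \<psi> unfolding G_def unital_star_hom_def by simp
  have G_ann: "G (ann A i)" if "i \<in> A" for i
    using that ann by (simp add: G_def)
  have G_sum: "G (op_sum f I)" if "finite I" "\<And>i. i \<in> I \<Longrightarrow> G (f i)" for f and I :: "('a set \<times> 'a set) set"
    using that
  proof (induction I rule: finite_induct)
    case empty
    have "op_sum f {} = op_scale 0 (op_one A)"
      by (simp add: op_sum_def op_scale_def)
    then show ?case using G_scale[OF G_one] by simp
  next
    case (insert i I)
    then have "op_sum f (insert i I) = op_add (f i) (op_sum f I)"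
      by (simp add: op_sum_def op_add_def)
    with insert show ?case by (simp add: G_add)
  qed
  have fin: "finite S" if "S \<subseteq> A" for S using that A finite_subset by blast
  \<comment> \<open>The projection onto the states with every mode of \<open>F\<close> empty, built
    by one factor \<open>a a^dagger\<close> per mode. For \<open>F = A\<close> it is the vacuum
    projection.\<close>
  define empty_on where "empty_on F = (\<lambda>S T. if S = T \<and> S \<subseteq> A \<and> S \<inter> F = {} then 1 else 0 :: complex)" for F
  have G_empty_on: "G (empty_on F)" if "finite F" "F \<subseteq> A" for F
    using that
  proof (induction F rule: finite_induct)
    case empty
    have "empty_on {} = op_one A" by (simp add: empty_on_def op_one_def)
    with G_one show ?case by simp
  next
    case (insert i F)
    have "empty_on (insert i F) = op_mult A (ann A i) (op_mult A (op_adj (ann A i)) (empty_on F))"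
    proof (intro ext)
      fix S U
      show "empty_on (insert i F) S U = op_mult A (ann A i) (op_mult A (op_adj (ann A i)) (empty_on F)) S U"
        using insert.hyps insert.prems A fin[of S]
        by (auto simp: ann_mult cre_mult jw_insert empty_on_def simp flip: cre_def)
    qed
    with insert show ?case by (simp add: G_mult G_ann G_adj)
  qed
  \<comment> \<open>The matrix unit from the vacuum to \<open>S\<close>. Creators build it from the
    vacuum projection, and a factor \<open>jw i S\<close> undoes the sign of each.\<close>
  define ket where "ket S = (\<lambda>S' T :: 'a set. if S' = S \<and> T = {} then 1 else 0 :: complex)" for S :: "'a set"
  have G_ket: "G (ket S)" if "finite S" "S \<subseteq> A" for S
    using that
  proof (induction S rule: finite_induct)
    case empty
    have "ket {} = empty_on A" by (auto simp: ket_def empty_on_def fun_eq_iff)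
    with G_empty_on[OF A] show ?case by simp
  next
    case (insert i S)
    have "ket (insert i S) = op_scale (jw i S) (op_mult A (op_adj (ann A i)) (ket S))"
    proof (intro ext)
      fix S' T
      have "i \<in> S' \<and> S' - {i} = S \<longleftrightarrow> S' = insert i S"
        using insert.hyps by auto
      then show "ket (insert i S) S' T = op_scale (jw i S) (op_mult A (op_adj (ann A i)) (ket S)) S' T"
        using insert.hyps insert.prems A
        by (auto simp: cre_mult jw_insert ket_def op_scale_def simp flip: cre_def)
    qed
    with insert show ?case by (simp add: G_mult G_ann G_adj G_scale)
  qed
  have unit: "op_mult A (ket S) (op_adj (ket T)) S' T' = (if S' = S \<and> T' = T then 1 else 0)" for S T S' T'
  proof -
    have "op_mult A (ket S) (op_adj (ket T)) S' T' = (\<Sum>R\<in>Pow A. if R = {} then if S' = S \<and> T' = T then 1 else 0 else 0)"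
      unfolding op_mult_def by (intro sum.cong) (auto simp: ket_def op_adj_def)
    then show ?thesis using A by simp
  qed
  have G_all: "G X" if "is_op A X" for X
  proof -
    have "X = op_sum (\<lambda>(S, T). op_scale (X S T) (op_mult A (ket S) (op_adj (ket T)))) (Pow A \<times> Pow A)"
    proof (intro ext)
      fix S U
      have "op_sum (\<lambda>(S, T). op_scale (X S T) (op_mult A (ket S) (op_adj (ket T)))) (Pow A \<times> Pow A) S U
          = (\<Sum>p\<in>Pow A \<times> Pow A. if p = (S, U) then X S U else 0)"
        unfolding op_sum_def by (intro sum.cong) (auto simp: op_scale_def unit split: if_splits)
      also have "\<dots> = X S U"
        using A that by (auto simp: is_op_def)
      finally show "X S U = op_sum (\<lambda>(S, T). op_scale (X S T) (op_mult A (ket S) (op_adj (ket T)))) (Pow A \<times> Pow A) S U"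
        by simp
    qed
    moreover have "G (op_sum (\<lambda>(S, T). op_scale (X S T) (op_mult A (ket S) (op_adj (ket T)))) (Pow A \<times> Pow A))"
      using A by (intro G_sum) (auto intro!: G_scale G_mult G_adj G_ket fin)
    ultimately show ?thesis by simp
  qed
  show ?thesis
  proof
    fix X
    show "\<phi> X = \<psi> X"
      using G_all[of X] \<phi> \<psi> unfolding G_def unital_star_hom_def by (cases "is_op A X") auto
  qed
qed

section \<open>Occupation of single slices and the explicit slice embedding\<close>

definition layer :: "nat \<Rightarrow> (nat \<times> nat) set \<Rightarrow> nat set" where
  "layer t S = {i. (t, i) \<in> S}"

definition off :: "nat \<Rightarrow> (nat \<times> nat) set \<Rightarrow> (nat \<times> nat) set" where
  "off t S = {x\<in>S. fst x \<noteq> t}"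

definition below :: "nat \<Rightarrow> (nat \<times> nat) set \<Rightarrow> nat" where
  "below t S = card {x\<in>S. fst x < t}"

definition replace :: "nat \<Rightarrow> nat set \<Rightarrow> (nat \<times> nat) set \<Rightarrow> (nat \<times> nat) set" where
  "replace t R S = off t S \<union> {t} \<times> R"

lemma finite_modes_h [simp]: "finite (modes_h L)"
  by (simp add: modes_h_def)

lemma layer_subset: "S \<subseteq> modes_H N L \<Longrightarrow> layer t S \<subseteq> modes_h L"
  by (auto simp: layer_def modes_H_def modes_h_def)

lemma layer_replace [simp]: "layer u (replace t R S) = (if u = t then R else layer u S)"
  by (auto simp: layer_def replace_def off_def)

lemma off_replace [simp]: "off t (replace t R S) = off t S"
  by (auto simp: replace_def off_def)

lemma replace_subset: "t < N \<Longrightarrow> S \<subseteq> modes_H N L \<Longrightarrow> R \<subseteq> modes_h L \<Longrightarrow> replace t R S \<subseteq> modes_H N L"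
  by (auto simp: replace_def off_def modes_H_def modes_h_def)

lemma layers_eqI: "(\<And>t. layer t S = layer t T) \<Longrightarrow> S = T"
  unfolding layer_def by auto

lemma off_eq_iff: "off t S = off t T \<longleftrightarrow> (\<forall>u. u \<noteq> t \<longrightarrow> layer u S = layer u T)"
  unfolding off_def layer_def set_eq_iff by auto

lemma below_cong: "(\<And>u. u < t \<Longrightarrow> layer u S = layer u T) \<Longrightarrow> below t S = below t T"
proof -
  assume "\<And>u. u < t \<Longrightarrow> layer u S = layer u T"
  then have "{x\<in>S. fst x < t} = {x\<in>T. fst x < t}"
    unfolding layer_def set_eq_iff by auto
  then show ?thesis by (simp only: below_def)
qed

lemma below_off: "off t S = off t T \<Longrightarrow> below t S = below t T"
  unfolding off_eq_iff by (rule below_cong) auto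

text \<open>A state that agrees with \<open>S\<close> off slice \<open>t\<close> is determined by
  its occupation of that slice.\<close>

lemma sum_off:
  assumes "t < N" "S \<subseteq> modes_H N L"
  shows "(\<Sum>T\<in>Pow (modes_H N L). if off t T = off t S then f T else 0)
    = (\<Sum>R\<in>Pow (modes_h L). f (replace t R S))"
proof -
  have "(\<Sum>T\<in>Pow (modes_H N L). if off t T = off t S then f T else 0)
      = (\<Sum>T\<in>{T\<in>Pow (modes_H N L). off t T = off t S}. f T)"
    by (rule sum.inter_filter[symmetric]) simp
  also have "\<dots> = (\<Sum>R\<in>Pow (modes_h L). f (replace t R S))"
  proof (rule sum.reindex_bij_witness[where i = "\<lambda>R. replace t R S" and j = "layer t"])
    fix T assume "T \<in> {T \<in> Pow (modes_H N L). off t T = off t S}"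
    then have T: "T \<subseteq> modes_H N L" "off t T = off t S" by auto
    show "replace t (layer t T) S = T"
      using T(2) by (intro layers_eqI) (auto simp: off_eq_iff)
    then show "f (replace t (layer t T) S) = f T" by simp
    show "layer t T \<in> Pow (modes_h L)" using T(1) layer_subset by blast
  next
    fix R assume "R \<in> Pow (modes_h L)"
    then show "replace t R S \<in> {T \<in> Pow (modes_H N L). off t T = off t S}"
      using assms replace_subset by auto
  qed simp
  finally show ?thesis .
qed

lemma minus_one_power_cong: "even (a + b) \<Longrightarrow> (-1) ^ a = ((-1) ^ b :: complex)"
  by (auto simp: minus_one_power_iff)

text \<open>The explicit matrix of a slice operator. Each ladder operator on slice \<open>t\<close>
  carries the sign of the particles on earlier slices, so only the parity of the change of
  occupation on the slice enters the exponent.\<close>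

definition place :: "nat \<Rightarrow> nat \<Rightarrow> nat \<Rightarrow> nat op \<Rightarrow> (nat \<times> nat) op" where
  "place N L t X = (\<lambda>S T. if S \<subseteq> modes_H N L \<and> T \<subseteq> modes_H N L \<and> off t S = off t T
     then (-1) ^ ((card (layer t S) + card (layer t T)) * below t T) * X (layer t S) (layer t T) else 0)"

lemma is_op_place [simp]: "is_op (modes_H N L) (place N L t X)"
  by (simp add: is_op_def place_def)

lemma place_mult_apply:
  assumes "t < N" "S \<subseteq> modes_H N L"
  shows "op_mult (modes_H N L) (place N L t X) Y S U
    = (\<Sum>R\<in>Pow (modes_h L). (-1) ^ ((card (layer t S) + card R) * below t S) * X (layer t S) R * Y (replace t R S) U)"
proof -
  have "op_mult (modes_H N L) (place N L t X) Y S U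
    = (\<Sum>T\<in>Pow (modes_H N L). if off t T = off t S
        then (-1) ^ ((card (layer t S) + card (layer t T)) * below t S) * X (layer t S) (layer t T) * Y T U else 0)"
    unfolding op_mult_def using assms by (intro sum.cong) (auto simp: place_def dest: below_off)
  then show ?thesis by (simp add: sum_off[OF assms])
qed

text \<open>The intermediate occupation enters the two sign exponents twice and drops out modulo 2,
  while the count below slice \<open>t\<close> is the same for all states involved.\<close>

lemma place_mult:
  assumes "t < N"
  shows "op_mult (modes_H N L) (place N L t X) (place N L t Y) = place N L t (op_mult (modes_h L) X Y)"
proof (intro ext)
  fix S U
  show "op_mult (modes_H N L) (place N L t X) (place N L t Y) S U = place N L t (op_mult (modes_h L) X Y) S U"
  proof (cases "S \<subseteq> modes_H N L \<and> U \<subseteq> modes_H N L \<and> off t S = off t U")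
    case True
    have "op_mult (modes_H N L) (place N L t X) (place N L t Y) S U
      = (\<Sum>R\<in>Pow (modes_h L). (-1) ^ ((card (layer t S) + card R) * below t S) * X (layer t S) R
          * place N L t Y (replace t R S) U)"
      using True assms by (simp add: place_mult_apply)
    also have "\<dots> = (\<Sum>R\<in>Pow (modes_h L). (-1) ^ ((card (layer t S) + card (layer t U)) * below t U)
          * (X (layer t S) R * Y R (layer t U)))"
    proof (intro sum.cong refl)
      fix R assume R: "R \<in> Pow (modes_h L)"
      have b: "below t S = below t U" using True by (intro below_off) simp
      have sgn: "(-1) ^ ((card (layer t S) + card R) * below t U) * (-1) ^ ((card R + card (layer t U)) * below t U)
          = ((-1) ^ ((card (layer t S) + card (layer t U)) * below t U) :: complex)"
        unfolding power_add[symmetric] by (rule minus_one_power_cong) auto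
      have pl: "place N L t Y (replace t R S) U = (-1) ^ ((card R + card (layer t U)) * below t U) * Y R (layer t U)"
        using True R assms replace_subset[of t N S L R] by (simp add: place_def)
      show "(-1) ^ ((card (layer t S) + card R) * below t S) * X (layer t S) R * place N L t Y (replace t R S) U
          = (-1) ^ ((card (layer t S) + card (layer t U)) * below t U) * (X (layer t S) R * Y R (layer t U))"
        unfolding pl b sgn[symmetric] by (simp only: mult_ac)
    qed
    also have "\<dots> = place N L t (op_mult (modes_h L) X Y) S U"
      using True by (simp add: place_def op_mult_def sum_distrib_left)
    finally show ?thesis .
  next
    case False
    then have "place N L t X S T * place N L t Y T U = 0" for T
      by (auto simp: place_def)
    then have "op_mult (modes_H N L) (place N L t X) (place N L t Y) S U = 0"
      unfolding op_mult_def by (intro sum.neutral) blast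
    moreover have "place N L t (op_mult (modes_h L) X Y) S U = 0"
      unfolding place_def using False by (rule if_not_P)
    ultimately show ?thesis by simp
  qed
qed

lemma place_one: "place N L t (op_one (modes_h L)) = op_one (modes_H N L)"
proof (intro ext)
  fix S T
  have "S = T" if "off t S = off t T" "layer t S = layer t T"
    using that by (intro layers_eqI) (auto simp: off_eq_iff)
  then show "place N L t (op_one (modes_h L)) S T = op_one (modes_H N L) S T"
    by (auto simp: place_def op_one_def layer_subset)
qed

lemma place_add: "place N L t (op_add X Y) = op_add (place N L t X) (place N L t Y)"
  by (auto simp: place_def op_add_def fun_eq_iff distrib_left)

lemma place_scale: "place N L t (op_scale c X) = op_scale c (place N L t X)"
  by (auto simp: place_def op_scale_def fun_eq_iff)

lemma place_adj: "place N L t (op_adj X) = op_adj (place N L t X)"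
  by (auto simp: place_def op_adj_def fun_eq_iff add.commute dest: below_off)

text \<open>In the lexicographic order the modes before \<open>(t, i)\<close> are those on earlier
  slices and the earlier ones on slice \<open>t\<close>, so the Jordan-Wigner sign factors
  accordingly.\<close>

lemma place_ann:
  assumes "t < N" "i \<in> modes_h L"
  shows "place N L t (ann (modes_h L) i) = ann (modes_H N L) (t, i)"
proof (intro ext)
  fix S T
  show "place N L t (ann (modes_h L) i) S T = ann (modes_H N L) (t, i) S T"
  proof (cases "T \<subseteq> modes_H N L \<and> i \<in> layer t T \<and> S = T - {(t, i)}")
    case True
    then have fin: "finite T" using finite_subset[of T "modes_H N L"] by simp
    have l: "layer t S = layer t T - {i}" "off t S = off t T" "S \<subseteq> modes_H N L" "layer t T \<subseteq> modes_h L"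
      using True layer_subset[of T N L t] by (auto simp: layer_def off_def)
    have fl: "finite (layer t T)" using l(4) finite_subset by fastforce
    have "{x\<in>T. x < (t, i)} = {x\<in>T. fst x < t} \<union> Pair t ` {j\<in>layer t T. j < i}"
      by (auto simp: layer_def less_prod_def image_iff)
    moreover have "{x\<in>T. fst x < t} \<inter> Pair t ` {j\<in>layer t T. j < i} = {}" by auto
    ultimately have "card {x\<in>T. x < (t, i)} = below t T + card {j\<in>layer t T. j < i}"
      using fin fl by (simp add: card_Un_disjoint below_def card_image inj_on_def)
    then have jw: "jw (t, i) T = (-1) ^ below t T * jw i (layer t T)"
      by (simp add: jw_def power_add)
    have "card (layer t T) = Suc (card (layer t S))"
      unfolding l(1) using True fl by (simp only: card_Suc_Diff1)
    then have "(-1) ^ ((card (layer t S) + card (layer t T)) * below t T) = ((-1) ^ below t T :: complex)"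
      by (intro minus_one_power_cong) simp
    then show ?thesis
      using True l assms by (auto simp: place_def ann_apply jw layer_def modes_H_def modes_h_def)
  next
    case False
    have "S = T - {(t, i)}" if "off t S = off t T" "layer t S = layer t T - {i}"
    proof (rule layers_eqI)
      show "layer u S = layer u (T - {(t, i)})" for u
        using that by (cases "u = t") (auto simp: off_eq_iff layer_def)
    qed
    then have "\<not> (T \<subseteq> modes_H N L \<and> off t S = off t T \<and> i \<in> layer t T \<and> layer t S = layer t T - {i})"
      using False by blast
    then have "place N L t (ann (modes_h L) i) S T = 0"
      unfolding place_def ann_apply by (simp split: if_split) blast
    moreover have "ann (modes_H N L) (t, i) S T = 0"
      unfolding ann_apply using False by (intro if_not_P) (auto simp: layer_def)
    ultimately show ?thesis by simp
  qed
qed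

text \<open>\<open>place\<close> is a homomorphism with the prescribed values on the annihilators,
  and \<open>unital_star_hom_eqI\<close> says that there is only one.\<close>

lemma slice_eq_place:
  assumes "t < N" "is_op (modes_h L) X"
  shows "slice N L t X = place N L t X"
proof -
  \<comment> \<open>The value \<open>op_zero\<close> outside the operators is the normalisation
    built into \<open>unital_star_hom\<close>.\<close>
  let ?\<phi> = "\<lambda>X. if is_op (modes_h L) X then place N L t X else op_zero"
  let ?P = "\<lambda>\<phi>. unital_star_hom (modes_h L) (modes_H N L) \<phi> \<and>
       (\<forall>i\<in>{1..L}. \<phi> (ann (modes_h L) i) = ann (modes_H N L) (t, i))"
  have "?P ?\<phi>"
    using assms(1) place_ann[OF assms(1), of _ L] unfolding modes_h_def[symmetric]
    by (auto simp: unital_star_hom_def place_add place_scale place_mult place_one place_adj)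
  moreover have "\<psi> = ?\<phi>" if "?P \<psi>" for \<psi>
    using that \<open>?P ?\<phi>\<close> by (intro unital_star_hom_eqI[of "modes_h L" "modes_H N L"]) (auto simp: modes_h_def)
  ultimately have "(THE \<phi>. ?P \<phi>) = ?\<phi>"
    by (rule the_equality)
  then show ?thesis
    unfolding slice_def using assms(2) by simp
qed

section \<open>The trace of an ordered product\<close>

lemma finite_subset_modes_H: "S \<subseteq> modes_H N L \<Longrightarrow> finite S"
  by (rule finite_subset[OF _ finite_modes_H])

lemma below_eq_sum:
  assumes "finite S"
  shows "below t S = (\<Sum>v<t. card (layer v S))"
proof -
  have "finite (layer v S)" for v
    using finite_imageI[OF assms, of snd] by (rule rev_finite_subset) (force simp: layer_def)
  moreover have "{x\<in>S. fst x < t} = (SIGMA v:{..<t}. layer v S)"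
    by (auto simp: layer_def)
  ultimately show ?thesis by (simp add: below_def)
qed

text \<open>Parity read off from matrix elements: \<open>True\<close> means odd, and the zero
  operator has both parities.\<close>

definition has_parity :: "bool \<Rightarrow> nat op \<Rightarrow> bool" where
  "has_parity p X \<longleftrightarrow> (\<forall>S T. X S T \<noteq> 0 \<longrightarrow> odd (card S + card T) = p)"

text \<open>The intermediate state is forced: it must agree with \<open>S\<close> off slice
  \<open>t\<close> and with \<open>U\<close> off slice \<open>u\<close>, hence is \<open>S\<close>
  with its slice \<open>t\<close> taken from \<open>U\<close>.\<close>

lemma place_place_apply:
  assumes "t < N" "t \<noteq> u" "S \<subseteq> modes_H N L" "U \<subseteq> modes_H N L"
  shows "op_mult (modes_H N L) (place N L t X) (place N L u Y) S U
    = (if \<forall>v. v \<noteq> t \<and> v \<noteq> u \<longrightarrow> layer v S = layer v U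
       then (-1) ^ ((card (layer t S) + card (layer t U)) * below t S + (card (layer u S) + card (layer u U)) * below u U)
         * (X (layer t S) (layer t U) * Y (layer u S) (layer u U)) else 0)"
proof -
  have off: "off u (replace t R S) = off u U
      \<longleftrightarrow> R = layer t U \<and> (\<forall>v. v \<noteq> t \<and> v \<noteq> u \<longrightarrow> layer v S = layer v U)" for R
    using assms(2) by (auto simp: off_eq_iff)
  have "op_mult (modes_H N L) (place N L t X) (place N L u Y) S U
      = (\<Sum>R\<in>Pow (modes_h L). (-1) ^ ((card (layer t S) + card R) * below t S) * X (layer t S) R
          * place N L u Y (replace t R S) U)"
    by (rule place_mult_apply[OF assms(1,3)])
  also have "\<dots> = (\<Sum>R\<in>Pow (modes_h L). if R = layer t U then
      (if \<forall>v. v \<noteq> t \<and> v \<noteq> u \<longrightarrow> layer v S = layer v U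
       then (-1) ^ ((card (layer t S) + card (layer t U)) * below t S + (card (layer u S) + card (layer u U)) * below u U)
         * (X (layer t S) (layer t U) * Y (layer u S) (layer u U)) else 0) else 0)"
  proof (intro sum.cong refl)
    fix R assume "R \<in> Pow (modes_h L)"
    then have sub: "replace t R S \<subseteq> modes_H N L" using assms replace_subset by blast
    have lu: "layer u (replace t R S) = layer u S" using assms(2) by simp
    have "place N L u Y (replace t R S) U = (if R = layer t U \<and> (\<forall>v. v \<noteq> t \<and> v \<noteq> u \<longrightarrow> layer v S = layer v U)
        then (-1) ^ ((card (layer u S) + card (layer u U)) * below u U) * Y (layer u S) (layer u U) else 0)"
      unfolding place_def off lu using sub assms(4) by simp
    then show "(-1) ^ ((card (layer t S) + card R) * below t S) * X (layer t S) R * place N L u Y (replace t R S) U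
      = (if R = layer t U then
      (if \<forall>v. v \<noteq> t \<and> v \<noteq> u \<longrightarrow> layer v S = layer v U
       then (-1) ^ ((card (layer t S) + card (layer t U)) * below t S + (card (layer u S) + card (layer u U)) * below u U)
         * (X (layer t S) (layer t U) * Y (layer u S) (layer u U)) else 0) else 0)"
      by (auto simp: power_add)
  qed
  also have "\<dots> = (if \<forall>v. v \<noteq> t \<and> v \<noteq> u \<longrightarrow> layer v S = layer v U
       then (-1) ^ ((card (layer t S) + card (layer t U)) * below t S + (card (layer u S) + card (layer u U)) * below u U)
         * (X (layer t S) (layer t U) * Y (layer u S) (layer u U)) else 0)"
    using layer_subset[OF assms(4), of t] by simp
  finally show ?thesis .
qed

text \<open>Acting on the later slice \<open>u\<close> does not affect the count below
  \<open>t\<close>. Acting on \<open>t\<close> changes the count below \<open>u\<close> by an odd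
  number exactly when \<open>X\<close> is odd, and this reaches the sign only if \<open>Y\<close> is
  odd too.\<close>

lemma place_commute_less:
  assumes "t < u" "u < N" "has_parity p X" "has_parity q Y"
  shows "op_mult (modes_H N L) (place N L t X) (place N L u Y)
    = op_scale (if p \<and> q then -1 else 1) (op_mult (modes_H N L) (place N L u Y) (place N L t X))"
proof (intro ext)
  fix S U
  let ?M = "modes_H N L"
  let ?goal = "op_mult ?M (place N L t X) (place N L u Y) S U
    = op_scale (if p \<and> q then -1 else 1) (op_mult ?M (place N L u Y) (place N L t X)) S U"
  show ?goal
  proof (cases "S \<subseteq> ?M \<and> U \<subseteq> ?M")
    case False
    have "is_op ?M (op_mult ?M (place N L t X) (place N L u Y))" "is_op ?M (op_mult ?M (place N L u Y) (place N L t X))"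
      by simp_all
    then have "op_mult ?M (place N L t X) (place N L u Y) S U = 0" "op_mult ?M (place N L u Y) (place N L t X) S U = 0"
      using False unfolding is_op_def by blast+
    then show ?thesis by (simp add: op_scale_def)
  next
    case True
    let ?agree = "\<forall>v. v \<noteq> t \<and> v \<noteq> u \<longrightarrow> layer v S = layer v U"
    let ?x = "X (layer t S) (layer t U)" and ?y = "Y (layer u S) (layer u U)"
    let ?a = "card (layer t S) + card (layer t U)" and ?b = "card (layer u S) + card (layer u U)"
    have tu: "op_mult ?M (place N L t X) (place N L u Y) S U
        = (if ?agree then (-1) ^ (?a * below t S + ?b * below u U) * (?x * ?y) else 0)"
      using place_place_apply[of t N u S L U X Y] True assms by simp
    have swap: "(\<forall>v. v \<noteq> u \<and> v \<noteq> t \<longrightarrow> layer v S = layer v U) \<longleftrightarrow> ?agree" by blast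
    have ut: "op_mult ?M (place N L u Y) (place N L t X) S U
        = (if ?agree then (-1) ^ (?b * below u S + ?a * below t U) * (?x * ?y) else 0)"
      using place_place_apply[of u N t S L U Y X] True assms unfolding swap mult.commute[of ?y ?x] by simp
    show ?thesis
    proof (cases "?agree \<and> ?x \<noteq> 0 \<and> ?y \<noteq> 0")
      case False
      then show ?thesis unfolding op_scale_def tu ut by auto
    next
      case agree: True
      have bt: "below t S = below t U"
        using agree assms(1) by (intro below_cong) auto
      have fin: "finite S" "finite U" using True finite_subset_modes_H by blast+
      \<comment> \<open>Among the slices before \<open>u\<close>, the two states can differ on
        \<open>t\<close> alone.\<close>
      have "(\<Sum>v<u. card (layer v S)) + card (layer t U) = (\<Sum>v<u. card (layer v U)) + card (layer t S)"
      proof -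
        have "(\<Sum>v\<in>{..<u} - {t}. card (layer v S)) = (\<Sum>v\<in>{..<u} - {t}. card (layer v U))"
          using agree by (intro sum.cong) auto
        then show ?thesis
          using assms(1) by (simp add: sum.remove[of "{..<u}" t])
      qed
      then have bu: "below u S + card (layer t U) = below u U + card (layer t S)"
        by (simp add: below_eq_sum fin)
      have par: "even ?a = (\<not> p)" "even ?b = (\<not> q)"
        using assms(3,4) agree unfolding has_parity_def by auto
      have "even (below u S + below u U) = even ?a"
        using bu by (metis even_add)
      then have "even ((?a * below t S + ?b * below u U) + ((if p \<and> q then 1 else 0) + (?b * below u S + ?a * below t U)))"
        using par unfolding bt by auto
      then have "(-1) ^ (?a * below t S + ?b * below u U)
          = ((-1) ^ ((if p \<and> q then 1 else 0) + (?b * below u S + ?a * below t U)) :: complex)"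
        by (rule minus_one_power_cong)
      then show ?thesis
        unfolding op_scale_def tu ut if_P[OF conjunct1[OF agree]] by simp
    qed
  qed
qed

lemma place_commute:
  assumes "t < N" "u < N" "t \<noteq> u" "has_parity p X" "has_parity q Y"
  shows "op_mult (modes_H N L) (place N L t X) (place N L u Y)
    = op_scale (if p \<and> q then -1 else 1) (op_mult (modes_H N L) (place N L u Y) (place N L t X))"
proof (cases "t < u")
  case True
  with assms place_commute_less show ?thesis by blast
next
  case False
  then have "op_mult (modes_H N L) (place N L u Y) (place N L t X)
    = op_scale (if q \<and> p then -1 else 1) (op_mult (modes_H N L) (place N L t X) (place N L u Y))"
    using assms place_commute_less[of u t N q Y p X] by simp
  then show ?thesis by (auto simp: op_scale_scale)
qed

text \<open>The latest slice stands leftmost, and replacing its occupation does not alter the counts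
  below earlier slices. Hence every sign can be evaluated on the single state
  \<open>S\<close>.\<close>

lemma ordered_place_apply:
  assumes "n \<le> N" "S \<subseteq> modes_H N L" "U \<subseteq> modes_H N L"
  shows "op_list_prod (modes_H N L) (map (\<lambda>t. place N L t (X t)) (rev [0..<n])) S U
    = (if \<forall>v\<ge>n. layer v S = layer v U
       then (-1) ^ (\<Sum>t<n. (card (layer t S) + card (layer t U)) * below t S) * (\<Prod>t<n. X t (layer t S) (layer t U)) else 0)"
  using assms(1,2)
proof (induction n arbitrary: S)
  case 0
  then show ?case using layers_eqI[of S U] by (auto simp: op_one_def)
next
  case (Suc n)
  let ?Z = "op_list_prod (modes_H N L) (map (\<lambda>t. place N L t (X t)) (rev [0..<n]))"
  let ?agree = "\<forall>v\<ge>Suc n. layer v S = layer v U"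
  let ?s = "\<Sum>t<n. (card (layer t S) + card (layer t U)) * below t S"
  have "op_list_prod (modes_H N L) (map (\<lambda>t. place N L t (X t)) (rev [0..<Suc n])) S U
      = op_mult (modes_H N L) (place N L n (X n)) ?Z S U"
    by simp
  also have "\<dots> = (\<Sum>R\<in>Pow (modes_h L). (-1) ^ ((card (layer n S) + card R) * below n S) * X n (layer n S) R * ?Z (replace n R S) U)"
    using Suc.prems by (intro place_mult_apply) auto
  also have "\<dots> = (\<Sum>R\<in>Pow (modes_h L). if R = layer n U then
      (if ?agree then (-1) ^ (\<Sum>t<Suc n. (card (layer t S) + card (layer t U)) * below t S) * (\<Prod>t<Suc n. X t (layer t S) (layer t U)) else 0)
      else 0)"
  proof (intro sum.cong refl)
    fix R assume "R \<in> Pow (modes_h L)"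
    then have sub: "replace n R S \<subseteq> modes_H N L" using Suc.prems replace_subset[of n N S L R] by auto
    have agree: "(\<forall>v\<ge>n. layer v (replace n R S) = layer v U) \<longleftrightarrow> R = layer n U \<and> ?agree"
      by (auto simp: le_Suc_eq Suc_le_eq)
    have below: "below t (replace n R S) = below t S" if "t < n" for t
      using that by (intro below_cong) auto
    have e1: "(\<Sum>t<n. (card (layer t (replace n R S)) + card (layer t U)) * below t (replace n R S)) = ?s"
      by (intro sum.cong refl) (simp add: below)
    have e2: "(\<Prod>t<n. X t (layer t (replace n R S)) (layer t U)) = (\<Prod>t<n. X t (layer t S) (layer t U))"
      by (intro prod.cong refl) simp
    have "?Z (replace n R S) U = (if R = layer n U \<and> ?agree then (-1) ^ ?s * (\<Prod>t<n. X t (layer t S) (layer t U)) else 0)"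
      unfolding e1[symmetric] e2[symmetric] agree[symmetric]
      using Suc.prems sub by (intro Suc.IH) auto
    then show "(-1) ^ ((card (layer n S) + card R) * below n S) * X n (layer n S) R * ?Z (replace n R S) U
      = (if R = layer n U then
        (if ?agree then (-1) ^ (\<Sum>t<Suc n. (card (layer t S) + card (layer t U)) * below t S) * (\<Prod>t<Suc n. X t (layer t S) (layer t U)) else 0)
        else 0)"
      by (simp add: power_add mult_ac) blast
  qed
  also have "\<dots> = (if ?agree then (-1) ^ (\<Sum>t<Suc n. (card (layer t S) + card (layer t U)) * below t S) * (\<Prod>t<Suc n. X t (layer t S) (layer t U)) else 0)"
    using layer_subset[OF assms(3), of n] by simp
  finally show ?case .
qed

text \<open>Parity is diagonal and the translation is a signed permutation, so the double sum over
  states collapses. The shift preserves the particle number, which lets the parity be evaluated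
  before it.\<close>

lemma trace_parity_transl:
  assumes "\<epsilon> > 0"
  shows "op_trace (modes_H N L) (op_mult (modes_H N L) (parity_op (modes_H N L)) (op_mult (modes_H N L) (transl \<epsilon> N L) Z))
    = (\<Sum>T\<in>Pow (modes_H N L). (-1) ^ card T * transl_sign N T * Z T (next_mode N ` T))"
proof -
  let ?M = "modes_H N L"
  have par: "op_mult ?M (parity_op ?M) Y S S = (-1) ^ card S * Y S S" if "S \<in> Pow ?M" for Y S
  proof -
    have "op_mult ?M (parity_op ?M) Y S S = (\<Sum>T\<in>Pow ?M. if T = S then (-1) ^ card S * Y S S else 0)"
      unfolding op_mult_def using that by (intro sum.cong) (auto simp: parity_op_apply)
    with that show ?thesis by simp
  qed
  have "op_trace ?M (op_mult ?M (parity_op ?M) (op_mult ?M (transl \<epsilon> N L) Z))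
      = (\<Sum>S\<in>Pow ?M. \<Sum>T\<in>Pow ?M. (-1) ^ card S * (transl \<epsilon> N L S T * Z T S))"
    unfolding op_trace_def by (simp add: par op_mult_def[of _ "transl \<epsilon> N L"] sum_distrib_left)
  also have "\<dots> = (\<Sum>T\<in>Pow ?M. \<Sum>S\<in>Pow ?M. (-1) ^ card S * (transl \<epsilon> N L S T * Z T S))"
    by (rule sum.swap)
  also have "\<dots> = (\<Sum>T\<in>Pow ?M. (-1) ^ card T * transl_sign N T * Z T (next_mode N ` T))"
  proof (intro sum.cong refl)
    fix T assume T: "T \<in> Pow ?M"
    have c: "card (next_mode N ` T) = card T"
      by (intro card_image inj_on_subset[OF inj_on_next_mode[of N L]]) (use T in auto)
    have m: "next_mode N ` T \<in> Pow ?M"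
      using T next_mode_in[of _ N L] by auto
    have "(\<Sum>S\<in>Pow ?M. (-1) ^ card S * (transl \<epsilon> N L S T * Z T S))
        = (\<Sum>S\<in>Pow ?M. if S = next_mode N ` T then (-1) ^ card T * transl_sign N T * Z T (next_mode N ` T) else 0)"
      using T assms by (intro sum.cong) (auto simp: transl_apply c)
    then show "(\<Sum>S\<in>Pow ?M. (-1) ^ card S * (transl \<epsilon> N L S T * Z T S))
        = (-1) ^ card T * transl_sign N T * Z T (next_mode N ` T)"
      using m by simp
  qed
  finally show ?thesis .
qed

section \<open>Cancellation of the signs on closed paths\<close>

lemma layer_next_mode:
  assumes "T \<subseteq> modes_H (Suc n) L"
  shows "layer t (next_mode (Suc n) ` T) = (if t = 0 then layer n T else if t \<le> n then layer (t - 1) T else {})"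
proof -
  have img: "(t, i) \<in> next_mode (Suc n) ` T \<longleftrightarrow> (t = 0 \<and> (n, i) \<in> T) \<or> (0 < t \<and> t \<le> n \<and> (t - 1, i) \<in> T)" for i
  proof
    assume "(t, i) \<in> next_mode (Suc n) ` T"
    then obtain u where u: "(u, i) \<in> T" "t = (if u = n then 0 else Suc u)" by (auto simp: next_mode_def)
    with assms have "u \<le> n" by (auto simp: modes_H_def)
    with u show "(t = 0 \<and> (n, i) \<in> T) \<or> (0 < t \<and> t \<le> n \<and> (t - 1, i) \<in> T)" by auto
  next
    assume "(t = 0 \<and> (n, i) \<in> T) \<or> (0 < t \<and> t \<le> n \<and> (t - 1, i) \<in> T)"
    then show "(t, i) \<in> next_mode (Suc n) ` T"
    proof
      assume "t = 0 \<and> (n, i) \<in> T"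
      then show ?thesis by (intro image_eqI[of _ _ "(n, i)"]) (auto simp: next_mode_def)
    next
      assume "0 < t \<and> t \<le> n \<and> (t - 1, i) \<in> T"
      then show ?thesis by (intro image_eqI[of _ _ "(t - 1, i)"]) (auto simp: next_mode_def)
    qed
  qed
  show ?thesis unfolding layer_def img by auto
qed

text \<open>Here \<open>c\<close> and \<open>d\<close> are the occupations of the slices before and
  after the shift. With \<open>s t\<close> the sum of \<open>c\<close> below \<open>t\<close>, the
  product \<open>d t * s t\<close> is \<open>c (t - 1) * s (t - 1) + c (t - 1)\<close> modulo 2 for
  \<open>t > 0\<close>, so the sum telescopes.\<close>

lemma ordering_sign_parity:
  fixes c d :: "nat \<Rightarrow> nat"
  assumes "\<And>t. t < k \<Longrightarrow> d (Suc t) = c t"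
  shows "even ((\<Sum>t<Suc k. (c t + d t) * (\<Sum>v<t. c v)) + c k * (\<Sum>v<k. c v) + (\<Sum>v<k. c v))"
  using assms
proof (induction k)
  case (Suc k)
  then have "even ((\<Sum>t<Suc k. (c t + d t) * (\<Sum>v<t. c v)) + c k * (\<Sum>v<k. c v) + (\<Sum>v<k. c v))" "d (Suc k) = c k"
    by simp_all
  then show ?case
    unfolding sum.lessThan_Suc[of _ "Suc k"] by (simp only: sum.lessThan_Suc[of c k]) auto
qed simp

text \<open>The signs of the parity operator, the translation and the slice embeddings multiply to
  1, which leaves a bare sum over cyclic paths. Writing the number of slices as \<open>Suc n\<close>
  makes \<open>n\<close> the last slice.\<close>

lemma trace_ordered_place:
  assumes "\<epsilon> > 0"
  shows "op_trace (modes_H (Suc n) L) (op_mult (modes_H (Suc n) L) (parity_op (modes_H (Suc n) L))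
      (op_mult (modes_H (Suc n) L) (transl \<epsilon> (Suc n) L)
        (op_list_prod (modes_H (Suc n) L) (map (\<lambda>t. place (Suc n) L t (X t)) (rev [0..<Suc n])))))
    = (\<Sum>T\<in>Pow (modes_H (Suc n) L). \<Prod>t<Suc n. X t (layer t T) (if t = 0 then layer n T else layer (t - 1) T))"
  unfolding trace_parity_transl[OF assms]
proof (intro sum.cong refl)
  let ?M = "modes_H (Suc n) L"
  fix T assume "T \<in> Pow ?M"
  then have T: "T \<subseteq> ?M" by simp
  let ?U = "next_mode (Suc n) ` T"
  have U: "?U \<subseteq> ?M" using T next_mode_in[of _ "Suc n" L] by auto
  have fin: "finite T" using T by (rule finite_subset_modes_H)
  let ?c = "\<lambda>t. card (layer t T)"
  let ?e = "\<Sum>t<Suc n. (?c t + card (layer t ?U)) * below t T"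
  have agree: "\<forall>v\<ge>Suc n. layer v T = layer v ?U"
  proof (intro allI impI)
    fix v assume "Suc n \<le> v"
    then show "layer v T = layer v ?U"
      unfolding layer_next_mode[OF T] using T by (auto simp: layer_def modes_H_def)
  qed
  have prod: "(\<Prod>t<Suc n. X t (layer t T) (layer t ?U)) = (\<Prod>t<Suc n. X t (layer t T) (if t = 0 then layer n T else layer (t - 1) T))"
    by (intro prod.cong refl) (auto simp: layer_next_mode[OF T])
  have last: "card {x\<in>T. Suc (fst x) = Suc n} = ?c n"
  proof -
    have "{x\<in>T. Suc (fst x) = Suc n} = Pair n ` layer n T" by (auto simp: layer_def)
    then show ?thesis by (simp only: card_image inj_on_def prod.inject simp_thms) (auto intro: card_image simp: inj_on_def)
  qed
  have rest: "card {x\<in>T. Suc (fst x) \<noteq> Suc n} = below n T"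
    unfolding below_def by (rule arg_cong[where f = card]) (use T in \<open>force simp: modes_H_def\<close>)
  have "card T = below (Suc n) T"
    unfolding below_def by (rule arg_cong[where f = card]) (use T in \<open>force simp: modes_H_def\<close>)
  then have cardT: "card T = below n T + ?c n" by (simp add: below_eq_sum fin)
  have "even (?e + ?c n * below n T + below n T)"
    unfolding below_eq_sum[OF fin] by (rule ordering_sign_parity) (simp add: layer_next_mode[OF T])
  \<comment> \<open>Parity contributes \<open>below n T + ?c n\<close> and the shift
    \<open>?c n * (1 + below n T)\<close>; together with \<open>?e\<close> they agree modulo 2 with
    the sum just shown to be even.\<close>
  then have "even ((card T + ?c n * (1 + below n T) + ?e) + 0)"
    unfolding cardT by auto
  then have "(-1) ^ (card T + ?c n * (1 + below n T) + ?e) = ((-1) ^ 0 :: complex)"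
    by (rule minus_one_power_cong)
  then have "(-1) ^ card T * transl_sign (Suc n) T * (-1) ^ ?e = (1 :: complex)"
    unfolding transl_sign_def last rest power_add by simp
  then show "(-1) ^ card T * transl_sign (Suc n) T
      * op_list_prod ?M (map (\<lambda>t. place (Suc n) L t (X t)) (rev [0..<Suc n])) T ?U
    = (\<Prod>t<Suc n. X t (layer t T) (if t = 0 then layer n T else layer (t - 1) T))"
    unfolding ordered_place_apply[OF order_refl T U] if_P[OF agree] prod
    by (simp only: mult.assoc[symmetric] mult_1)
qed

section \<open>Matrix products as sums over paths of occupation sets\<close>

lemma sum_Pow_modes_H_Suc:
  "(\<Sum>S\<in>Pow (modes_H (Suc n) L). f S) = (\<Sum>R\<in>Pow (modes_h L). \<Sum>S\<in>Pow (modes_H n L). f (replace n R S))"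
proof -
  have "(\<Sum>S\<in>Pow (modes_H (Suc n) L). f S) = (\<Sum>(R, S)\<in>Pow (modes_h L) \<times> Pow (modes_H n L). f (replace n R S))"
  proof (rule sum.reindex_bij_witness[where i = "\<lambda>(R, S). replace n R S" and j = "\<lambda>S. (layer n S, off n S)"])
    fix S assume S: "S \<in> Pow (modes_H (Suc n) L)"
    show *: "(case (layer n S, off n S) of (R, S) \<Rightarrow> replace n R S) = S"
      by (auto simp: replace_def layer_def off_def)
    show "(layer n S, off n S) \<in> Pow (modes_h L) \<times> Pow (modes_H n L)"
      using S by (fastforce simp: layer_def off_def modes_H_def modes_h_def)
    show "(case (layer n S, off n S) of (R, S) \<Rightarrow> f (replace n R S)) = f S"
      using * by simp
  next
    fix p assume "p \<in> Pow (modes_h L) \<times> Pow (modes_H n L)"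
    then obtain R S where p: "p = (R, S)" "R \<subseteq> modes_h L" "S \<subseteq> modes_H n L" by auto
    then have "fst x \<noteq> n" if "x \<in> S" for x using that by (auto simp: modes_H_def)
    then have "off n S = S" by (auto simp: off_def)
    then show "(layer n (case p of (R, S) \<Rightarrow> replace n R S), off n (case p of (R, S) \<Rightarrow> replace n R S)) = p"
      by (simp add: p)
    have "S \<subseteq> modes_H (Suc n) L" using p(3) by (auto simp: modes_H_def)
    then show "(case p of (R, S) \<Rightarrow> replace n R S) \<in> Pow (modes_H (Suc n) L)"
      using p replace_subset[of n "Suc n" S L R] by simp
  qed
  then show ?thesis by (simp add: sum.cartesian_product)
qed

text \<open>Multiplying \<open>n + 1\<close> matrices sums over \<open>n\<close> intermediate sets,
  packed here as the layers of one subset of \<open>modes_H n L\<close>. The outer indices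
  \<open>A\<close> and \<open>B\<close> are the ends of the path.\<close>

lemma op_list_prod_paths:
  assumes "\<And>t. is_op (modes_h L) (X t)"
  shows "op_list_prod (modes_h L) (map X (rev [0..<Suc n])) A B
    = (\<Sum>S\<in>Pow (modes_H n L). \<Prod>t<Suc n. X t (if t = n then A else layer t S) (if t = 0 then B else layer (t - 1) S))"
proof (induction n arbitrary: A)
  case 0
  show ?case using assms by (simp add: modes_H_def op_mult_one_right)
next
  case (Suc n)
  let ?X = "\<lambda>S A t. X t (if t = Suc n then A else layer t S) (if t = 0 then B else layer (t - 1) S)"
  have "op_list_prod (modes_h L) (map X (rev [0..<Suc (Suc n)])) A B
      = (\<Sum>R\<in>Pow (modes_h L). X (Suc n) A R * op_list_prod (modes_h L) (map X (rev [0..<Suc n])) R B)"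
    by (simp add: op_mult_def[of _ "X (Suc n)"])
  also have "\<dots> = (\<Sum>R\<in>Pow (modes_h L). \<Sum>S\<in>Pow (modes_H n L). \<Prod>t<Suc (Suc n). ?X (replace n R S) A t)"
  proof (intro sum.cong refl)
    fix R
    have "(\<Prod>t<Suc n. X t (if t = n then R else layer t S) (if t = 0 then B else layer (t - 1) S))
        = (\<Prod>t<Suc n. ?X (replace n R S) A t)" for S
      by (intro prod.cong refl) auto
    then show "X (Suc n) A R * op_list_prod (modes_h L) (map X (rev [0..<Suc n])) R B
        = (\<Sum>S\<in>Pow (modes_H n L). \<Prod>t<Suc (Suc n). ?X (replace n R S) A t)"
      unfolding Suc.IH prod.lessThan_Suc[of _ "Suc n"] sum_distrib_left
      by (intro sum.cong refl) (simp add: mult.commute)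
  qed
  also have "\<dots> = (\<Sum>S\<in>Pow (modes_H (Suc n) L). \<Prod>t<Suc (Suc n). ?X S A t)"
    by (rule sum_Pow_modes_H_Suc[symmetric])
  finally show ?case .
qed

text \<open>The small trace identifies the two ends of each path; their common value becomes slice
  \<open>n\<close> of a state of the large space. Both traces are then the same sum over closed
  paths.\<close>

lemma trace_ordered:
  assumes "\<epsilon> > 0" "N \<ge> 1" "\<And>t. is_op (modes_h L) (X t)"
  shows "op_trace (modes_H N L) (op_mult (modes_H N L) (parity_op (modes_H N L))
      (op_mult (modes_H N L) (transl \<epsilon> N L)
        (op_list_prod (modes_H N L) (map (\<lambda>t. place N L t (X t)) (rev [0..<N])))))
    = op_trace (modes_h L) (op_list_prod (modes_h L) (map X (rev [0..<N])))"
proof -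
  obtain n where N: "N = Suc n" using assms(2) by (cases N) auto
  have "(\<Prod>t<Suc n. X t (if t = n then A else layer t S) (if t = 0 then A else layer (t - 1) S))
      = (\<Prod>t<Suc n. X t (layer t (replace n A S)) (if t = 0 then layer n (replace n A S) else layer (t - 1) (replace n A S)))" for A S
    by (intro prod.cong refl) auto
  then show ?thesis
    unfolding N trace_ordered_place[OF assms(1)] unfolding op_trace_def op_list_prod_paths[OF assms(3)] sum_Pow_modes_H_Suc
    by (simp only:)
qed

section \<open>Time ordering\<close>

lemma mult_parity_op:
  assumes "is_op (modes_h L) X"
  shows "op_mult (modes_h L) X (parity_op (modes_h L)) S T = (-1) ^ card T * X S T"
    and "op_mult (modes_h L) (parity_op (modes_h L)) X S T = (-1) ^ card S * X S T"
proof -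
  have "op_mult (modes_h L) X (parity_op (modes_h L)) S T
      = (\<Sum>R\<in>Pow (modes_h L). if R = T then (-1) ^ card T * X S T else 0)"
    unfolding op_mult_def by (intro sum.cong) (auto simp: parity_op_apply)
  then show "op_mult (modes_h L) X (parity_op (modes_h L)) S T = (-1) ^ card T * X S T"
    using assms by (auto simp: is_op_def)
  have "op_mult (modes_h L) (parity_op (modes_h L)) X S T
      = (\<Sum>R\<in>Pow (modes_h L). if R = S then (-1) ^ card S * X S T else 0)"
    unfolding op_mult_def by (intro sum.cong) (auto simp: parity_op_apply)
  then show "op_mult (modes_h L) (parity_op (modes_h L)) X S T = (-1) ^ card S * X S T"
    using assms by (auto simp: is_op_def)
qed

lemma is_even_op_iff:
  assumes "is_op (modes_h L) X"
  shows "is_even_op L X \<longleftrightarrow> has_parity False X"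
proof -
  have "(-1) ^ card T * X S T = (-1) ^ card S * X S T \<longleftrightarrow> (X S T \<noteq> 0 \<longrightarrow> even (card S + card T))" for S T
    by (auto simp: minus_one_power_iff)
  then show ?thesis
    unfolding is_even_op_def has_parity_def fun_eq_iff mult_parity_op[OF assms] by auto
qed

lemma is_odd_op_iff:
  assumes "is_op (modes_h L) X"
  shows "is_odd_op L X \<longleftrightarrow> has_parity True X"
proof -
  have "(-1) ^ card T * X S T = - 1 * ((-1) ^ card S * X S T) \<longleftrightarrow> (X S T \<noteq> 0 \<longrightarrow> odd (card S + card T))" for S T
    by (auto simp: minus_one_power_iff)
  then show ?thesis
    unfolding is_odd_op_def has_parity_def fun_eq_iff op_scale_def mult_parity_op[OF assms] by simp
qed

lemma is_op_diff [simp]: "is_op M X \<Longrightarrow> is_op M Y \<Longrightarrow> is_op M (op_diff X Y)"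
  unfolding is_op_def op_diff_def by (metis diff_0_right)

text \<open>Each matrix element either preserves or changes the parity of the particle number, so
  the defining conditions fix it entry by entry.\<close>

lemma even_part_apply:
  assumes "is_op (modes_h L) X"
  shows "even_part L X = (\<lambda>S T. if even (card S + card T) then X S T else 0)" (is "_ = ?E")
  unfolding even_part_def
proof (rule the_equality)
  have E: "is_op (modes_h L) ?E" using assms by (auto simp: is_op_def)
  moreover have "has_parity False ?E" "has_parity True (op_diff X ?E)"
    by (auto simp: has_parity_def op_diff_def)
  ultimately show "is_op (modes_h L) ?E \<and> is_even_op L ?E \<and> is_odd_op L (op_diff X ?E)"
    using assms by (simp add: is_even_op_iff is_odd_op_iff)
next
  fix E assume "is_op (modes_h L) E \<and> is_even_op L E \<and> is_odd_op L (op_diff X E)"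
  then have E: "has_parity False E" "has_parity True (op_diff X E)"
    using assms by (auto simp: is_even_op_iff is_odd_op_iff)
  show "E = ?E"
  proof (intro ext)
    fix S T
    show "E S T = ?E S T"
      using E[unfolded has_parity_def op_diff_def, THEN spec, THEN spec, of S T]
      by (cases "even (card S + card T)") (auto simp del: even_add odd_add)
  qed
qed

lemma even_odd_parts:
  assumes "is_op (modes_h L) X"
  shows "is_op (modes_h L) (even_part L X)" "is_op (modes_h L) (odd_part L X)"
    and "has_parity False (even_part L X)" "has_parity True (odd_part L X)"
    and "op_add (even_part L X) (odd_part L X) = X"
  using assms
  by (auto simp: odd_part_def even_part_apply is_op_def has_parity_def op_diff_def op_add_def fun_eq_iff split: if_splits)

text \<open>Decreasing labels with ties in the original order amount to a strictly increasing
  lexicographic key \<open>(- s l, l)\<close>. The key is injective, so a sorting permutation exists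
  and is unique.\<close>

lemma sort_perm_sorts:
  fixes s :: "nat \<Rightarrow> real"
  shows "sort_perm k s permutes {0..<k}"
    and "p < q \<Longrightarrow> q < k \<Longrightarrow> s (sort_perm k s q) \<le> s (sort_perm k s p)"
    and "p < q \<Longrightarrow> q < k \<Longrightarrow> s (sort_perm k s p) = s (sort_perm k s q) \<Longrightarrow> sort_perm k s p < sort_perm k s q"
proof -
  define key where "key l = (- s l, l)" for l :: nat
  have inj: "inj key" by (auto simp: inj_def key_def)
  let ?P = "\<lambda>\<sigma>. \<sigma> permutes {0..<k} \<and>
       (\<forall>p q. p < q \<and> q < k \<longrightarrow> s (\<sigma> q) \<le> s (\<sigma> p)) \<and>
       (\<forall>p q. p < q \<and> q < k \<and> s (\<sigma> p) = s (\<sigma> q) \<longrightarrow> \<sigma> p < \<sigma> q)"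
  have P_iff: "?P \<sigma> \<longleftrightarrow> \<sigma> permutes {0..<k} \<and> (\<forall>p q. p < q \<and> q < k \<longrightarrow> key (\<sigma> p) < key (\<sigma> q))" for \<sigma>
    unfolding key_def less_prod_def by (auto simp: order.order_iff_strict) (metis order_less_irrefl)+
  define xs where "xs = sort_key key [0..<k]"
  have xs: "distinct xs" "set xs = {0..<k}" "length xs = k" "sorted (map key xs)"
    by (auto simp: xs_def)
  define \<sigma>0 where "\<sigma>0 p = (if p < k then xs ! p else p)" for p
  have "bij_betw \<sigma>0 {0..<k} {0..<k}"
  proof -
    have "bij_betw ((!) xs) {..<length xs} (set xs)"
      using xs(1) by (rule bij_betw_nth) auto
    then show ?thesis
      unfolding xs by (subst bij_betw_cong[of _ _ "(!) xs"]) (auto simp: \<sigma>0_def atLeast0LessThan)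
  qed
  then have perm: "\<sigma>0 permutes {0..<k}"
    by (rule bij_imp_permutes) (auto simp: \<sigma>0_def)
  have ord: "key (\<sigma>0 p) < key (\<sigma>0 q)" if "p < q" "q < k" for p q
  proof -
    have "key (xs ! p) \<le> key (xs ! q)"
      using sorted_nth_mono[OF xs(4), of p q] that xs(3) by simp
    moreover have "key (xs ! p) \<noteq> key (xs ! q)"
      using inj xs(1,3) that by (simp add: inj_eq nth_eq_iff_index_eq)
    ultimately show ?thesis using that by (simp add: \<sigma>0_def)
  qed
  have P0: "?P \<sigma>0" unfolding P_iff using perm ord by blast
  \<comment> \<open>Two such permutations list the same set of keys in strictly increasing order,
    hence give the same list.\<close>
  moreover have "\<sigma> = \<sigma>0" if "?P \<sigma>" for \<sigma>
  proof -
    have list: "sorted (map (key \<circ> \<tau>) [0..<k])" "distinct (map (key \<circ> \<tau>) [0..<k])"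
      "set (map (key \<circ> \<tau>) [0..<k]) = key ` {0..<k}" if "?P \<tau>" for \<tau>
    proof -
      have \<tau>: "\<tau> permutes {0..<k}" "\<And>p q. p < q \<Longrightarrow> q < k \<Longrightarrow> key (\<tau> p) < key (\<tau> q)"
        using that unfolding P_iff by blast+
      show "sorted (map (key \<circ> \<tau>) [0..<k])"
        by (auto simp: sorted_iff_nth_mono_less intro: less_imp_le \<tau>(2))
      show "distinct (map (key \<circ> \<tau>) [0..<k])"
        using inj permutes_inj[OF \<tau>(1)] by (auto simp: distinct_map intro: inj_on_subset[OF inj_compose])
      show "set (map (key \<circ> \<tau>) [0..<k]) = key ` {0..<k}"
        by (simp only: set_map set_upt image_comp[symmetric] permutes_image[OF \<tau>(1)])
    qed
    have "map (key \<circ> \<sigma>) [0..<k] = map (key \<circ> \<sigma>0) [0..<k]"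
      using list[OF that] list[OF P0] by (intro sorted_distinct_set_unique) simp_all
    then have "\<sigma> p = \<sigma>0 p" if "p < k" for p
      using that inj by (auto simp: inj_eq)
    moreover have "\<sigma> p = \<sigma>0 p" if "\<not> p < k" for p
      using that \<open>?P \<sigma>\<close> by (auto simp: \<sigma>0_def permutes_def)
    ultimately show ?thesis by blast
  qed
  ultimately have "sort_perm k s = \<sigma>0"
    unfolding sort_perm_def by (rule the_equality)
  with P0 show "sort_perm k s permutes {0..<k}"
    and "p < q \<Longrightarrow> q < k \<Longrightarrow> s (sort_perm k s q) \<le> s (sort_perm k s p)"
    and "p < q \<Longrightarrow> q < k \<Longrightarrow> s (sort_perm k s p) = s (sort_perm k s q) \<Longrightarrow> sort_perm k s p < sort_perm k s q"
    by auto
qed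

section \<open>Sorting signs: inversions among the odd factors\<close>

fun inversions :: "nat set \<Rightarrow> nat list \<Rightarrow> nat" where
  "inversions A [] = 0"
| "inversions A (x # xs) = (if x \<in> A then length (filter (\<lambda>y. y \<in> A \<and> y < x) xs) else 0) + inversions A xs"

text \<open>The recursion follows insertion sort, while \<open>time_order\<close> counts pairs of
  positions. The pairs split into those that start at the head and shifted copies of those in the
  tail.\<close>

lemma inversions_eq_card:
  "inversions A xs = card {(p, q). p < q \<and> q < length xs \<and> xs ! p \<in> A \<and> xs ! q \<in> A \<and> xs ! q < xs ! p}"
proof (induction xs)
  case (Cons x xs)
  define I where "I xs = {(p, q). p < q \<and> q < length xs \<and> xs ! p \<in> A \<and> xs ! q \<in> A \<and> xs ! q < xs ! p}" for xs
  have fin: "finite (I xs)" for xs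
    by (rule finite_subset[of _ "{..<length xs} \<times> {..<length xs}"]) (auto simp: I_def)
  let ?J = "{q. q < length xs \<and> x \<in> A \<and> xs ! q \<in> A \<and> xs ! q < x}"
  have "I (x # xs) = (\<lambda>q. (0, Suc q)) ` ?J \<union> map_prod Suc Suc ` I xs"
  proof (intro set_eqI iffI)
    fix r assume r: "r \<in> I (x # xs)"
    obtain p q where pq: "r = (p, q)" by (cases r)
    with r obtain q' where q': "q = Suc q'" by (cases q) (auto simp: I_def)
    show "r \<in> (\<lambda>q. (0, Suc q)) ` ?J \<union> map_prod Suc Suc ` I xs"
    proof (cases p)
      case 0
      with r pq q' show ?thesis by (auto simp: I_def)
    next
      case (Suc p')
      with r pq q' have "(p', q') \<in> I xs" by (auto simp: I_def)
      then show ?thesis unfolding pq q' Suc by force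
    qed
  qed (auto simp: I_def)
  moreover have "(\<lambda>q. (0, Suc q)) ` ?J \<inter> map_prod Suc Suc ` I xs = {}" by auto
  moreover have "card ((\<lambda>q. (0 :: nat, Suc q)) ` ?J) = card ?J" by (intro card_image) (auto simp: inj_on_def)
  moreover have "card (map_prod Suc Suc ` I xs) = card (I xs)" by (intro card_image) (auto simp: inj_on_def)
  moreover have "card ?J = (if x \<in> A then length (filter (\<lambda>y. y \<in> A \<and> y < x) xs) else 0)"
    by (simp add: length_filter_conv_card)
  ultimately have "card (I (x # xs)) = (if x \<in> A then length (filter (\<lambda>y. y \<in> A \<and> y < x) xs) else 0) + card (I xs)"
    using fin[of xs] by (simp add: card_Un_disjoint)
  with Cons show ?case by (simp add: I_def)
qed simp

text \<open>The factor \<open>Z x\<close> moves right past the smaller entries only, with one sign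
  for each odd one among them if \<open>x\<close> is odd.\<close>

lemma op_list_prod_insort:
  assumes M: "finite M" and Z: "\<And>l. is_op M (Z l)"
    and comm: "\<And>y. y \<in> set ys \<Longrightarrow> y < x \<Longrightarrow>
      op_mult M (Z x) (Z y) = op_scale (if x \<in> A \<and> y \<in> A then -1 else 1) (op_mult M (Z y) (Z x))"
    and "sorted ys"
  shows "op_mult M (Z x) (op_list_prod M (map Z ys))
    = op_scale ((-1) ^ (if x \<in> A then length (filter (\<lambda>y. y \<in> A \<and> y < x) ys) else 0))
        (op_list_prod M (map Z (insort x ys)))"
  using comm \<open>sorted ys\<close>
proof (induction ys)
  case Nil
  show ?case by simp
next
  case (Cons y ys)
  show ?case
  proof (cases "x \<le> y")
    case True
    then have "filter (\<lambda>y. y \<in> A \<and> y < x) (y # ys) = []"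
      using Cons.prems(2) by (auto simp: filter_empty_conv)
    then show ?thesis using True by (simp only: insort_key.simps) simp
  next
    case False
    let ?c = "if x \<in> A \<and> y \<in> A then -1 else 1 :: complex"
    let ?n = "\<lambda>ys. if x \<in> A then length (filter (\<lambda>y. y \<in> A \<and> y < x) ys) else 0"
    have "op_mult M (Z x) (op_list_prod M (map Z (y # ys)))
        = op_mult M (op_mult M (Z x) (Z y)) (op_list_prod M (map Z ys))"
      by (simp add: op_mult_assoc M)
    also have "\<dots> = op_scale ?c (op_mult M (Z y) (op_mult M (Z x) (op_list_prod M (map Z ys))))"
      using Cons.prems(1)[of y] False by (simp add: op_mult_scale_left op_mult_assoc M)
    also have "op_mult M (Z x) (op_list_prod M (map Z ys)) = op_scale ((-1) ^ ?n ys) (op_list_prod M (map Z (insort x ys)))"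
      using Cons.prems by (intro Cons.IH) auto
    finally show ?thesis
      using False by (simp add: op_mult_scale_right op_scale_scale not_le)
  qed
qed

text \<open>Insertion sort exchanges only pairs that stand in the wrong order in \<open>xs\<close>,
  so the exchange rule is demanded for these alone. Factors at equal times, which need not commute,
  are never exchanged.\<close>

lemma op_list_prod_sort:
  assumes M: "finite M" and Z: "\<And>l. is_op M (Z l)"
    and "sorted_wrt (\<lambda>x y. y < x \<longrightarrow>
      op_mult M (Z x) (Z y) = op_scale (if x \<in> A \<and> y \<in> A then -1 else 1) (op_mult M (Z y) (Z x))) xs"
  shows "op_list_prod M (map Z xs) = op_scale ((-1) ^ inversions A xs) (op_list_prod M (map Z (sort xs)))"
  using assms(3)
proof (induction xs)
  case Nil
  show ?case by simp
next
  case (Cons x xs)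
  have "length (filter P (sort xs)) = length (filter P xs)" for P
    by (simp add: filter_sort)
  moreover have "op_mult M (Z x) (op_list_prod M (map Z (sort xs)))
      = op_scale ((-1) ^ (if x \<in> A then length (filter (\<lambda>y. y \<in> A \<and> y < x) (sort xs)) else 0))
          (op_list_prod M (map Z (insort x (sort xs))))"
    using Cons.prems by (intro op_list_prod_insort M Z) auto
  ultimately show ?case
    using Cons by (simp add: op_mult_scale_right op_scale_scale power_add mult.commute)
qed

section \<open>Grouping factors by slice and expanding into parities\<close>

lemma filter_split_sorted:
  fixes \<tau> :: "'a \<Rightarrow> nat"
  assumes "sorted_wrt (\<lambda>x y. \<tau> y \<le> \<tau> x) xs" "\<forall>x\<in>set xs. \<tau> x < Suc n"
  shows "xs = filter (\<lambda>x. \<tau> x = n) xs @ filter (\<lambda>x. \<tau> x < n) xs"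
  using assms
proof (induction xs)
  case (Cons x xs)
  show ?case
  proof (cases "\<tau> x = n")
    case True
    with Cons show ?thesis by simp
  next
    case False
    then have "\<forall>y\<in>set (x # xs). \<tau> y < n" using Cons.prems by force
    then have "filter (\<lambda>x. \<tau> x = n) (x # xs) = []" "filter (\<lambda>x. \<tau> x < n) (x # xs) = x # xs"
      by (auto simp: filter_empty_conv intro!: filter_True)
    then show ?thesis by simp
  qed
qed simp

text \<open>A time-ordered product is cut into one block per slice, an absent block being the
  identity. Stating it for a general \<open>F\<close> covers both the slice embedding on the large
  space and the identity map on the small one.\<close>

lemma op_list_prod_group:
  assumes M: "finite M"
    and F_op: "\<And>t X. is_op h X \<Longrightarrow> is_op M (F t X)"
    and F_one: "\<And>t. t < n \<Longrightarrow> F t (op_one h) = op_one M"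
    and F_mult: "\<And>t X Y. t < n \<Longrightarrow> is_op h X \<Longrightarrow> is_op h Y \<Longrightarrow> F t (op_mult h X Y) = op_mult M (F t X) (F t Y)"
    and Y: "\<And>l. is_op h (Y l)"
    and "sorted_wrt (\<lambda>x y. \<tau> y \<le> \<tau> x) xs" "\<forall>x\<in>set xs. \<tau> x < (n::nat)"
  shows "op_list_prod M (map (\<lambda>l. F (\<tau> l) (Y l)) xs)
    = op_list_prod M (map (\<lambda>t. F t (op_list_prod h (map Y (filter (\<lambda>l. \<tau> l = t) xs)))) (rev [0..<n]))"
  using F_one F_mult assms(6,7)
proof (induction n arbitrary: xs)
  case 0
  then show ?case by simp
next
  case (Suc n)
  have hom: "op_list_prod M (map (\<lambda>l. F n (Y l)) ys) = F n (op_list_prod h (map Y ys))" for ys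
    by (induction ys) (simp_all add: Suc.prems(1,2) Y is_op_list_prod)
  let ?hi = "filter (\<lambda>l. \<tau> l = n) xs" and ?lo = "filter (\<lambda>l. \<tau> l < n) xs"
  have "map (\<lambda>l. F (\<tau> l) (Y l)) xs = map (\<lambda>l. F n (Y l)) ?hi @ map (\<lambda>l. F (\<tau> l) (Y l)) ?lo"
    by (subst filter_split_sorted[OF Suc.prems(3,4)]) simp
  then have "op_list_prod M (map (\<lambda>l. F (\<tau> l) (Y l)) xs)
      = op_mult M (F n (op_list_prod h (map Y ?hi))) (op_list_prod M (map (\<lambda>l. F (\<tau> l) (Y l)) ?lo))"
    using M F_op Y by (simp add: op_list_prod_append hom)
  also have "op_list_prod M (map (\<lambda>l. F (\<tau> l) (Y l)) ?lo)
      = op_list_prod M (map (\<lambda>t. F t (op_list_prod h (map Y (filter (\<lambda>l. \<tau> l = t) ?lo)))) (rev [0..<n]))"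
    using Suc.prems by (intro Suc.IH) (auto intro: sorted_wrt_filter)
  also have "map (\<lambda>t. F t (op_list_prod h (map Y (filter (\<lambda>l. \<tau> l = t) ?lo)))) (rev [0..<n])
      = map (\<lambda>t. F t (op_list_prod h (map Y (filter (\<lambda>l. \<tau> l = t) xs)))) (rev [0..<n])"
  proof (intro map_cong refl)
    fix t assume "t \<in> set (rev [0..<n])"
    then have "filter (\<lambda>l. \<tau> l = t) ?lo = filter (\<lambda>l. \<tau> l = t) xs"
      by (auto intro!: filter_cong)
    then show "F t (op_list_prod h (map Y (filter (\<lambda>l. \<tau> l = t) ?lo)))
        = F t (op_list_prod h (map Y (filter (\<lambda>l. \<tau> l = t) xs)))" by (simp only:)
  qed
  finally show ?case by simp
qed

text \<open>Distributivity, with \<open>A\<close> the set of positions that take the second summand;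
  this is how \<open>time_order\<close> indexes its odd factors.\<close>

lemma op_list_prod_add_expand:
  assumes M: "finite M" and "\<And>l. l < k \<Longrightarrow> is_op M (f l)" "\<And>l. l < k \<Longrightarrow> is_op M (g l)"
  shows "op_list_prod M (map (\<lambda>l. op_add (f l) (g l)) [0..<k])
    = op_sum (\<lambda>A. op_list_prod M (map (\<lambda>l. if l \<in> A then g l else f l) [0..<k])) (Pow {0..<k})"
  using assms(2,3)
proof (induction k)
  case 0
  show ?case by (simp add: op_sum_def)
next
  case (Suc k)
  let ?Q = "\<lambda>k A. op_list_prod M (map (\<lambda>l. if l \<in> A then g l else f l) [0..<k])"
  have Q_Suc: "?Q (Suc k) A = op_mult M (?Q k A) (if k \<in> A then g k else f k)" for A
    using M Suc.prems by (auto simp: op_list_prod_append op_mult_one_right)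
  have Q_insert: "?Q k (insert k A) = ?Q k A" for A
    by (intro arg_cong[where f = "op_list_prod M"] map_cong) auto
  \<comment> \<open>The choices split according to whether the last factor takes \<open>f k\<close>
    or \<open>g k\<close>.\<close>
  have pow: "Pow {0..<Suc k} = Pow {0..<k} \<union> insert k ` Pow {0..<k}"
    by (simp add: atLeast0_lessThan_Suc Pow_insert)
  have disj: "Pow {0..<k} \<inter> insert k ` Pow {0..<k} = {}" by auto
  have inj: "inj_on (insert k) (Pow {0..<k})"
    by (rule inj_onI) (metis Diff_insert_absorb PowD atLeastLessThan_iff less_irrefl subsetD)
  have "op_list_prod M (map (\<lambda>l. op_add (f l) (g l)) [0..<Suc k])
      = op_mult M (op_sum (?Q k) (Pow {0..<k})) (op_add (f k) (g k))"
    using M Suc by (simp add: op_list_prod_append op_mult_one_right)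
  also have "\<dots> = op_sum (?Q (Suc k)) (Pow {0..<Suc k})"
  proof (intro ext)
    fix S T
    have "op_sum (?Q (Suc k)) (Pow {0..<Suc k}) S T
        = (\<Sum>A\<in>Pow {0..<k}. ?Q (Suc k) A S T) + (\<Sum>A\<in>Pow {0..<k}. ?Q (Suc k) (insert k A) S T)"
      unfolding op_sum_def pow using disj inj by (simp add: sum.union_disjoint sum.reindex)
    also have "(\<Sum>A\<in>Pow {0..<k}. ?Q (Suc k) A S T) = (\<Sum>A\<in>Pow {0..<k}. op_mult M (?Q k A) (f k) S T)"
      by (intro sum.cong refl) (subst Q_Suc; auto)
    also have "(\<Sum>A\<in>Pow {0..<k}. ?Q (Suc k) (insert k A) S T) = (\<Sum>A\<in>Pow {0..<k}. op_mult M (?Q k A) (g k) S T)"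
      by (intro sum.cong refl) (simp only: Q_Suc Q_insert insertI1 if_True)
    finally show "op_mult M (op_sum (?Q k) (Pow {0..<k})) (op_add (f k) (g k)) S T
        = op_sum (?Q (Suc k)) (Pow {0..<Suc k}) S T"
      unfolding op_mult_linear by (simp only: op_add_def op_sum_def)
  qed
  finally show ?case .
qed

text \<open>With definite parities, sorting the factors by time costs the fermionic sign. Grouping
  the sorted product by slice then brings it to the form of \<open>trace_ordered\<close>.\<close>

lemma trace_homogeneous:
  fixes \<tau> :: "nat \<Rightarrow> nat"
  assumes "N \<ge> 1" "\<epsilon> > 0"
    and Y: "\<And>l. is_op (modes_h L) (Y l)" "\<And>l. has_parity (l \<in> A) (Y l)"
    and \<tau>: "\<And>l. l < k \<Longrightarrow> \<tau> l < N"
  defines "\<sigma> \<equiv> sort_perm k (\<lambda>l. real (\<tau> l))"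
  shows "op_trace (modes_H N L) (op_mult (modes_H N L) (parity_op (modes_H N L))
      (op_mult (modes_H N L) (transl \<epsilon> N L)
        (op_list_prod (modes_H N L) (map (\<lambda>l. place N L (\<tau> l) (Y l)) [0..<k]))))
    = (-1) ^ card {(p, q). p < q \<and> q < k \<and> \<sigma> p \<in> A \<and> \<sigma> q \<in> A \<and> \<sigma> q < \<sigma> p}
      * op_trace (modes_h L) (op_list_prod (modes_h L) (map (\<lambda>p. Y (\<sigma> p)) [0..<k]))"
proof -
  let ?M = "modes_H N L"
  let ?Z = "\<lambda>l. place N L (\<tau> l) (Y l)"
  define xs where "xs = map \<sigma> [0..<k]"
  let ?X = "\<lambda>t. op_list_prod (modes_h L) (map Y (filter (\<lambda>l. \<tau> l = t) xs))"
  have perm: "\<sigma> permutes {0..<k}" unfolding \<sigma>_def by (rule sort_perm_sorts)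
  have set_xs: "set xs = {0..<k}" and dist: "distinct xs"
    using permutes_image[OF perm] permutes_inj_on[OF perm] by (auto simp: xs_def distinct_map)
  have sorted: "sorted_wrt (\<lambda>x y. \<tau> y \<le> \<tau> x) xs"
    using sort_perm_sorts(2)[of _ _ k "\<lambda>l. real (\<tau> l)"] by (auto simp: xs_def sorted_wrt_iff_nth_less \<sigma>_def)
  have comm: "op_mult ?M (?Z (xs ! p)) (?Z (xs ! q))
      = op_scale (if xs ! p \<in> A \<and> xs ! q \<in> A then -1 else 1) (op_mult ?M (?Z (xs ! q)) (?Z (xs ! p)))"
    if "p < q" "q < length xs" "xs ! q < xs ! p" for p q
  proof (rule place_commute[OF _ _ _ Y(2) Y(2)])
    have pq: "xs ! p = \<sigma> p" "xs ! q = \<sigma> q" "q < k" using that by (auto simp: xs_def)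
    \<comment> \<open>The sort is stable, so a pair whose order it reverses must lie on different
      slices.\<close>
    show "\<tau> (xs ! p) \<noteq> \<tau> (xs ! q)"
      using sort_perm_sorts(3)[of p q k "\<lambda>l. real (\<tau> l)"] that unfolding pq(1,2) \<sigma>_def[symmetric] using pq(3) by force
    have "xs ! p \<in> {0..<k}" "xs ! q \<in> {0..<k}" using that nth_mem[of _ xs] unfolding set_xs by auto
    then show "\<tau> (xs ! p) < N" "\<tau> (xs ! q) < N" using \<tau> by auto
  qed
  have "op_list_prod ?M (map ?Z xs) = op_scale ((-1) ^ inversions A xs) (op_list_prod ?M (map ?Z (sort xs)))"
    using comm by (intro op_list_prod_sort) (auto simp: sorted_wrt_iff_nth_less)
  moreover have "sort xs = [0..<k]"
    using set_xs dist by (intro sorted_distinct_set_unique) auto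
  \<comment> \<open>The sorting sign is its own inverse, so the relation just obtained can be read
    from the original order to the time order.\<close>
  moreover have "(-1) ^ n * (-1) ^ n = (1 :: complex)" for n
    by (simp flip: power_mult_distrib)
  ultimately have reorder: "op_list_prod ?M (map ?Z [0..<k]) = op_scale ((-1) ^ inversions A xs) (op_list_prod ?M (map ?Z xs))"
    by (simp add: op_scale_scale)
  have inv: "inversions A xs = card {(p, q). p < q \<and> q < k \<and> \<sigma> p \<in> A \<and> \<sigma> q \<in> A \<and> \<sigma> q < \<sigma> p}"
    unfolding inversions_eq_card by (rule arg_cong[where f = card]) (auto simp: xs_def)
  \<comment> \<open>The same blocks \<open>?X\<close> appear in the large and in the small space,
    which is what links the two traces.\<close>
  have "op_list_prod ?M (map ?Z xs) = op_list_prod ?M (map (\<lambda>t. place N L t (?X t)) (rev [0..<N]))"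
    using Y(1) \<tau> set_xs sorted
    by (intro op_list_prod_group[where F = "place N L" and h = "modes_h L"]) (auto simp: place_one place_mult)
  moreover have "op_list_prod (modes_h L) (map Y xs) = op_list_prod (modes_h L) (map ?X (rev [0..<N]))"
    using Y(1) \<tau> set_xs sorted
    by (intro op_list_prod_group[where F = "\<lambda>t X. X" and h = "modes_h L"]) auto
  moreover have "op_trace ?M (op_mult ?M (parity_op ?M) (op_mult ?M (transl \<epsilon> N L)
      (op_list_prod ?M (map (\<lambda>t. place N L t (?X t)) (rev [0..<N])))))
      = op_trace (modes_h L) (op_list_prod (modes_h L) (map ?X (rev [0..<N])))"
    using assms(1,2) Y(1) by (intro trace_ordered) (auto intro!: is_op_list_prod)
  ultimately have "op_trace ?M (op_mult ?M (parity_op ?M) (op_mult ?M (transl \<epsilon> N L) (op_list_prod ?M (map ?Z xs))))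
      = op_trace (modes_h L) (op_list_prod (modes_h L) (map Y xs))"
    by simp
  then show ?thesis
    unfolding reorder inv op_mult_scale_right op_trace_scale by (simp add: xs_def comp_def)
qed

theorem theorem2:
  fixes L N :: nat and \<epsilon> :: real and Os :: "nat op list" and ts :: "nat list"
  assumes "L \<ge> 1" and "N \<ge> 1" and "\<epsilon> > 0"
    and "length ts = length Os"
    and "\<forall>X\<in>set Os. is_op (modes_h L) X"
    and "\<forall>t\<in>set ts. t < N"
  shows "op_trace (modes_H N L)
           (op_mult (modes_H N L) (parity_op (modes_H N L))
             (op_mult (modes_H N L) (op_exp (modes_H N L) (op_scale (\<i> * of_real \<epsilon>) (calP \<epsilon> N L)))
               (op_list_prod (modes_H N L) (map2 (\<lambda>X t. slice N L t X) Os ts))))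
       = op_trace (modes_h L)
           (time_order L (length Os) (\<lambda>l. Os ! l) (\<lambda>l. real (ts ! l)))"
proof -
  let ?M = "modes_H N L" and ?k = "length Os"
  \<comment> \<open>The value \<open>op_zero\<close> beyond the list makes both families total;
    having both parities, it satisfies the hypotheses of \<open>trace_homogeneous\<close> at every
    index.\<close>
  define Ev Od where "Ev l = (if l < ?k then even_part L (Os ! l) else op_zero)"
    and "Od l = (if l < ?k then odd_part L (Os ! l) else op_zero)" for l
  define Y where "Y A l = (if l \<in> A then Od l else Ev l)" for A l
  let ?\<sigma> = "sort_perm ?k (\<lambda>l. real (ts ! l))"
  let ?\<gamma> = "\<lambda>A. card {(p, q). p < q \<and> q < ?k \<and> ?\<sigma> p \<in> A \<and> ?\<sigma> q \<in> A \<and> ?\<sigma> q < ?\<sigma> p}"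
  have zero: "is_op (modes_h L) op_zero" "has_parity p op_zero" for p
    by (auto simp: is_op_def has_parity_def op_zero_def)
  have op: "is_op (modes_h L) (Os ! l)" if "l < ?k" for l
    using assms(5) that by simp
  have Y: "is_op (modes_h L) (Y A l)" "has_parity (l \<in> A) (Y A l)" for A l
    using even_odd_parts[OF op, of l] zero by (auto simp: Y_def Ev_def Od_def)
  have \<tau>: "ts ! l < N" if "l < ?k" for l
    using assms(4,6) that by simp
  \<comment> \<open>Linearity of the embedding turns each slice operator into the sum of its
    embedded even and odd parts, ready for the multilinear expansion.\<close>
  have slices: "map2 (\<lambda>X t. slice N L t X) Os ts
      = map (\<lambda>l. op_add (place N L (ts ! l) (Ev l)) (place N L (ts ! l) (Od l))) [0..<?k]"
  proof (rule nth_equalityI)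
    fix l assume "l < length (map2 (\<lambda>X t. slice N L t X) Os ts)"
    then have l: "l < ?k" by simp
    then show "map2 (\<lambda>X t. slice N L t X) Os ts ! l
        = map (\<lambda>l. op_add (place N L (ts ! l) (Ev l)) (place N L (ts ! l) (Od l))) [0..<?k] ! l"
      using assms(4) op[OF l] \<tau>[OF l] even_odd_parts(5)[OF op[OF l]]
      by (simp add: slice_eq_place Ev_def Od_def flip: place_add)
  qed (use assms(4) in simp)
  have expand: "op_list_prod ?M (map2 (\<lambda>X t. slice N L t X) Os ts)
      = op_sum (\<lambda>A. op_list_prod ?M (map (\<lambda>l. place N L (ts ! l) (Y A l)) [0..<?k])) (Pow {0..<?k})"
    unfolding slices
    by (subst op_list_prod_add_expand) (simp_all add: Y_def if_distrib[of "place N L _"] cong: if_cong)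
  have "op_trace ?M (op_mult ?M (parity_op ?M) (op_mult ?M (transl \<epsilon> N L)
        (op_list_prod ?M (map2 (\<lambda>X t. slice N L t X) Os ts))))
      = (\<Sum>A\<in>Pow {0..<?k}. op_trace ?M (op_mult ?M (parity_op ?M) (op_mult ?M (transl \<epsilon> N L)
          (op_list_prod ?M (map (\<lambda>l. place N L (ts ! l) (Y A l)) [0..<?k])))))"
    unfolding expand op_mult_sum_right op_trace_sum ..
  also have "\<dots> = (\<Sum>A\<in>Pow {0..<?k}. (-1) ^ ?\<gamma> A
      * op_trace (modes_h L) (op_list_prod (modes_h L) (map (\<lambda>p. Y A (?\<sigma> p)) [0..<?k])))"
    by (intro sum.cong refl trace_homogeneous assms Y \<tau>)
  also have "\<dots> = op_trace (modes_h L) (time_order L ?k (\<lambda>l. Os ! l) (\<lambda>l. real (ts ! l)))"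
  proof -
    \<comment> \<open>The permutation stays within the list, so the default values never enter the
      time-ordered product.\<close>
    have "?\<sigma> p < ?k" if "p < ?k" for p
      using permutes_in_image[OF sort_perm_sorts(1)[of ?k "\<lambda>l. real (ts ! l)"], of p] that by simp
    then have "map (\<lambda>p. Y A (?\<sigma> p)) [0..<?k]
        = map (\<lambda>p. if ?\<sigma> p \<in> A then odd_part L (Os ! ?\<sigma> p) else even_part L (Os ! ?\<sigma> p)) [0..<?k]" for A
      by (auto simp: Y_def Ev_def Od_def)
    then show ?thesis
      unfolding time_order_def Let_def op_trace_sum op_trace_scale by (simp only:)
  qed
  finally show ?thesis unfolding transl_def .
qed

end
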